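(* For every positive integer $p$, the Dirichlet eigenvalues of the wedge $\mathbb{W}^2_{\pi/p}$ satisfy Pólya's conjecture, that is, $$\lambda_k(\mathbb{W}^2_{\pi/p})\ \ge\ C_{W,2}(\mathbb{W}^2_{\pi/p})\,k\qquad\text{for all } k\ge 1.$$
   Context: For a positive integer $p$, the wedge is the domain of the unit sphere $\mathbb{S}^n=\{x\in\mathbb{R}^{n+1}:\|x\|=1\}$ (round metric) given by $$\mathbb{W}^n_{\pi/p}=\mathbb{S}^n\cap\Big(\mathbb{R}^{n-1}\times\big\{(x_n,x_{n+1})\in\mathbb{R}\times\mathbb{R}_+:\ x_n=x_{n+1}\tan\varphi,\ \varphi\in(-\tfrac{\pi}{2p},\tfrac{\pi}{2p})\big\}\Big),$$ where $\mathbb{R}_+=(0,\infty)$; here $n=2$. In particular $\mathbb{W}^n_\pi$ is the hemisphere $\{x\in\mathbb{S}^n: x_{n+1}>0\}$. The Dirichlet eigenvalues of the Laplace-Beltrami operator, repeated according to multiplicity, are $0<\lambda_1\le\lambda_2\le\dots$. The Weyl constant of an $n$-dimensional manifold $M$ is $C_{W,n}(M)=4\pi^2/(\omega_n|M|)^{2/n}$, where $\omega_n$ is the volume of the unit ball in $\mathbb{R}^n$ and $|M|$ the volume of $M$. *)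

theory Defs
  imports "HOL-Analysis.Analysis" "HOL-Library.Function_Algebras"
begin

text \<open>
  Throughout, the unit sphere \<open>sphere 0 1\<close> of a Euclidean space of dimension \<open>n + 1\<close> carries the
  round metric, and \<open>M\<close> is a (relatively) open subset of it.  Since \<open>sgn x = x /\<^sub>R norm x\<close>, the map
  \<open>f \<circ> sgn\<close> is the extension of \<open>f\<close> to the punctured space that is constant along rays, and
  \<open>sgn -` M\<close> is the open cone over \<open>M\<close>.
\<close>


subsection \<open>The Laplace--Beltrami operator of the round sphere\<close>

text \<open>
  At a point \<open>x\<close> of the sphere the derivative of \<open>u \<circ> sgn\<close> vanishes in the radial direction and is
  the differential of \<open>u\<close> in tangential directions, so its Euclidean gradient is the Riemannian
  gradient of \<open>u\<close>, as a tangent vector.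
\<close>

definition sphere_grad :: "('a::euclidean_space \<Rightarrow> real) \<Rightarrow> 'a \<Rightarrow> 'a" where
  "sphere_grad u x = (\<Sum>b\<in>Basis. frechet_derivative (u \<circ> sgn) (at x) b *\<^sub>R b)"

text \<open>
  For a tangent field \<open>X\<close> the Levi-Civita derivative is the tangential part of the Euclidean one.
  As \<open>X \<circ> sgn\<close> is radially constant, the full trace below has no radial contribution and equals
  the trace of the Levi-Civita derivative over the tangent space.
\<close>

definition sphere_div :: "('a::euclidean_space \<Rightarrow> 'a) \<Rightarrow> 'a \<Rightarrow> real" where
  "sphere_div X x = (\<Sum>b\<in>Basis. frechet_derivative (X \<circ> sgn) (at x) b \<bullet> b)"

definition laplace_beltrami :: "('a::euclidean_space \<Rightarrow> real) \<Rightarrow> 'a \<Rightarrow> real" where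
  "laplace_beltrami u = sphere_div (sphere_grad u)"

definition C2_on :: "'a::euclidean_space set \<Rightarrow> ('a \<Rightarrow> real) \<Rightarrow> bool" where
  "C2_on U f \<longleftrightarrow>
     (\<exists>(f' :: 'a \<Rightarrow> 'a \<Rightarrow>\<^sub>L real) (f'' :: 'a \<Rightarrow> 'a \<Rightarrow>\<^sub>L 'a \<Rightarrow>\<^sub>L real).
        (\<forall>x\<in>U. (f has_derivative blinfun_apply (f' x)) (at x) \<and>
               (f' has_derivative blinfun_apply (f'' x)) (at x)) \<and>
        continuous_on U f'')"


subsection \<open>Dirichlet eigenvalues, repeated according to multiplicity\<close>

global_interpretation fun_vs: vector_space "\<lambda>(c::real) (f::'a \<Rightarrow> real). (\<lambda>x. c * f x)"
  by standard (auto simp: fun_eq_iff algebra_simps)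

text \<open>
  Solutions, of class \<open>C\<^sup>2\<close> in \<open>M\<close> and continuous up to the boundary, of the boundary value problem
  \<open>-\<Delta>u = \<mu>u\<close> in \<open>M\<close>, \<open>u = 0\<close> on the boundary.  Each function on the closure of \<open>M\<close> that vanishes on
  the boundary is represented by its extension by zero to the whole ambient space, so that the
  condition \<open>u x = 0\<close> for \<open>x \<notin> M\<close> contains the boundary condition.
\<close>

definition dirichlet_eigenspace :: "'a::euclidean_space set \<Rightarrow> real \<Rightarrow> ('a \<Rightarrow> real) set" where
  "dirichlet_eigenspace M \<mu> =
     {u. C2_on (sgn -` M) (u \<circ> sgn) \<and> continuous_on (closure M) u \<and> (\<forall>x. x \<notin> M \<longrightarrow> u x = 0) \<and>
         (\<forall>x\<in>M. - laplace_beltrami u x = \<mu> * u x)}"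

text \<open>
  A real \<open>\<mu>\<close> is an eigenvalue iff its eigenspace is nonzero; in the sequence it occurs exactly as
  often as the dimension of the eigenspace says.  Demanding a finite basis explicitly keeps
  infinite-dimensional eigenspaces from being counted with the default dimension 0.  The sequence
  is indexed from 0.
\<close>

definition enumerates_dirichlet_spectrum :: "'a::euclidean_space set \<Rightarrow> (nat \<Rightarrow> real) \<Rightarrow> bool" where
  "enumerates_dirichlet_spectrum M lam \<longleftrightarrow>
     mono lam \<and>
     (\<forall>\<mu>. finite {i. lam i = \<mu>} \<and>
          (\<exists>B. finite B \<and> fun_vs.independent B \<and> fun_vs.span B = dirichlet_eigenspace M \<mu> \<and>
               card B = card {i. lam i = \<mu>}))"

lemma mono_eq_if_card_fibres_eq:
  fixes f g :: "nat \<Rightarrow> real"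
  assumes "mono f" "mono g"
    and fin: "\<And>\<mu>. finite {i. f i = \<mu>}" "\<And>\<mu>. finite {i. g i = \<mu>}"
    and card: "\<And>\<mu>. card {i. f i = \<mu>} = card {i. g i = \<mu>}"
  shows "f = g"
proof -
  have no_less: False
    if m: "mono g" and fin: "\<And>\<mu>. finite {i. f i = \<mu>}"
      and card: "\<And>\<mu>. card {i. f i = \<mu>} = card {i. g i = \<mu>}"
      and eq: "\<forall>k<n. f k = g k" and lt: "f n < g n"
    for f g :: "nat \<Rightarrow> real" and n
  proof -
    have "k < n" if "g k = f n" for k
      using that lt monoD[OF m, of n k] by linarith
    with eq have "{i. g i = f n} \<subseteq> {i. f i = f n} - {n}" by auto
    hence "{i. g i = f n} \<subset> {i. f i = f n}" by auto
    from psubset_card_mono[OF fin this] card[of "f n"] show False by simp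
  qed
  have "f n = g n" for n
  proof (induction n rule: less_induct)
    case (less n)
    hence eq: "\<forall>k<n. f k = g k" "\<forall>k<n. g k = f k" by auto
    have "\<not> f n < g n"
      using no_less[OF \<open>mono g\<close> fin(1) card eq(1)] by blast
    moreover have "\<not> g n < f n"
      using no_less[OF \<open>mono f\<close> fin(2) card[symmetric] eq(2)] by blast
    ultimately show ?case by linarith
  qed
  thus ?thesis by blast
qed

lemma enumerates_dirichlet_spectrum_unique:
  assumes "enumerates_dirichlet_spectrum M lam" "enumerates_dirichlet_spectrum M lam'"
  shows "lam = lam'"
proof -
  have dim: "card {i. l i = \<mu>} = fun_vs.dim (dirichlet_eigenspace M \<mu>)"
    if "enumerates_dirichlet_spectrum M l" for l \<mu>
  proof -
    from that obtain B where "fun_vs.independent B"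
      "fun_vs.span B = dirichlet_eigenspace M \<mu>" "card B = card {i. l i = \<mu>}"
      unfolding enumerates_dirichlet_spectrum_def by blast
    thus ?thesis
      using fun_vs.dim_span_eq_card_independent[of B] by simp
  qed
  show ?thesis
  proof (rule mono_eq_if_card_fibres_eq)
    show "mono lam" "mono lam'"
      using assms by (simp_all add: enumerates_dirichlet_spectrum_def)
    show "finite {i. lam i = \<mu>}" "finite {i. lam' i = \<mu>}" for \<mu>
      using assms by (simp_all add: enumerates_dirichlet_spectrum_def)
    show "card {i. lam i = \<mu>} = card {i. lam' i = \<mu>}" for \<mu>
      by (simp only: dim[OF assms(1)] dim[OF assms(2)])
  qed
qed

text \<open>\<open>dirichlet_eigenvalue M k\<close> is \<open>\<lambda>\<^sub>k(M)\<close> for \<open>k \<ge> 1\<close>.\<close>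

definition dirichlet_eigenvalue :: "'a::euclidean_space set \<Rightarrow> nat \<Rightarrow> real" where
  "dirichlet_eigenvalue M k = (THE lam. enumerates_dirichlet_spectrum M lam) (k - 1)"


subsection \<open>Volume, Weyl constant and wedges\<close>

text \<open>
  The Riemannian volume on the sphere is given by the polar coordinates formula
  \<open>vol {r x |x r. x \<in> M, 0 < r < 1} = |M| \<integral>\<^sub>0\<^sup>1 r\<^sup>n dr\<close> with \<open>n + 1\<close> the dimension of the ambient space.
\<close>

definition sphere_volume :: "'a::euclidean_space set \<Rightarrow> real" where
  "sphere_volume M =
     real DIM('a) * measure lebesgue {r *\<^sub>R x | r x. 0 < r \<and> r < 1 \<and> x \<in> M}"

definition weyl_constant :: "'a::euclidean_space set \<Rightarrow> real" where
  "weyl_constant M =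
     (let n = real (DIM('a) - 1)
      in 4 * pi\<^sup>2 / (unit_ball_vol n * sphere_volume M) powr (2 / n))"

definition wedge :: "nat \<Rightarrow> (real ^ 3) set" where
  "wedge p = {x \<in> sphere 0 1. x $ 3 > 0 \<and>
     (\<exists>\<phi>\<in>{- pi / (2 * real p) <..< pi / (2 * real p)}. x $ 2 = x $ 3 * tan \<phi>)}"

end

theory Submission
  imports Defs
begin

text \<open>
  With \<open>\<zeta> = \<i> (x\<^sub>3 + \<i> x\<^sub>2)\<^sup>p\<close>, the functions \<open>G(x\<^sub>1) Im (\<zeta>\<^sup>m)\<close>, with \<open>G\<close> the \<open>(l + pm)\<close>-th derivative of
  \<open>(t\<^sup>2 - 1)\<^sup>l\<close> and \<open>1 \<le> m \<le> l / p\<close>, are Dirichlet eigenfunctions of the wedge with eigenvalue \<open>l (l + 1)\<close>.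
  They exhaust the spectrum.  The span of the products \<open>q(x\<^sub>1) Im (\<zeta>\<^sup>m)\<close> is uniformly dense in the
  continuous functions vanishing on the boundary, by Stone--Weierstrass.  By the maximum
  principle, the resolvent \<open>(c - \<Delta>)\<^sup>-\<^sup>1\<close> is bounded by \<open>1 / c\<close> in the supremum norm, and on the span it
  is symmetric; hence it is symmetric against every classical eigenfunction \<open>u\<close>, without any control of
  \<open>\<nabla>u\<close> at the boundary.  So \<open>u\<close> is orthogonal to all explicit eigenfunctions with a different eigenvalue.

  Therefore the multiplicity of \<open>l (l + 1)\<close> is \<open>\<lfloor>l / p\<rfloor>\<close>, and the number of eigenvalues up to \<open>l (l + 1)\<close> is
  \<open>\<Sum>\<^sub>j\<^sub>\<le>\<^sub>l \<lfloor>j / p\<rfloor> \<le> l (l + 1) / (2 p)\<close>.  The Weyl constant is at most \<open>2 p\<close>, as \<open>2 p\<close> rotated copies of the wedge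
  cover the sphere up to a null set.
\<close>

subsection \<open>Second-order calculus on Euclidean space\<close>

text \<open>The eigenvalues are read off a complete list with multiplicities, so a lower bound for
  the k-th one cannot come from test functions: every classical eigenfunction has to be accounted
  for. The obstacle is the boundary. Eigenfunctions are only assumed continuous up to it, and it has
  corners at the poles when p > 1, so Green's formula against an arbitrary eigenfunction is not at
  hand. With the resolvent, the only integration by parts left is one between explicit polynomials
  in one variable. The resolvent carries a shift c because the sign of an eigenvalue is not known
  beforehand. The factor \<i> in \<zeta> turns the opening angle into (0, pi). There the sines of
  the multiple angles vanish at both ends, which is the boundary condition, and the cosine is
  injective, which separates points for Stone--Weierstrass. The two sides of the inequality meet at
  2 p k.\<close>

definition C2_jet ::
  "'a::euclidean_space set \<Rightarrow> ('a \<Rightarrow> real) \<Rightarrow> ('a \<Rightarrow> 'a \<Rightarrow>\<^sub>L real) \<Rightarrow> ('a \<Rightarrow> 'a \<Rightarrow>\<^sub>L 'a \<Rightarrow>\<^sub>L real) \<Rightarrow> bool"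
  where
  "C2_jet U f f' f'' \<longleftrightarrow>
     (\<forall>x\<in>U. (f has_derivative blinfun_apply (f' x)) (at x) \<and>
             (f' has_derivative blinfun_apply (f'' x)) (at x)) \<and> continuous_on U f''"

definition laplacian :: "('a::euclidean_space \<Rightarrow> real) \<Rightarrow> 'a \<Rightarrow> real" where
  "laplacian f x =
     (\<Sum>b\<in>Basis. frechet_derivative (\<lambda>y. frechet_derivative f (at y) b) (at x) b)"

text \<open>The carre du champ: the cross term in the product rule for \<open>laplacian\<close> and
  the second-order factor in its chain rule.\<close>

definition grad_inner :: "('a::euclidean_space \<Rightarrow> real) \<Rightarrow> ('a \<Rightarrow> real) \<Rightarrow> 'a \<Rightarrow> real" where
  "grad_inner f g x =
     (\<Sum>b\<in>Basis. frechet_derivative f (at x) b * frechet_derivative g (at x) b)"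

lemma C2_on_iff_jet: "C2_on U f \<longleftrightarrow> (\<exists>f' f''. C2_jet U f f' f'')"
  by (simp add: C2_on_def C2_jet_def)

lemma C2_jetD:
  assumes "C2_jet U f f' f''" "x \<in> U"
  shows "(f has_derivative blinfun_apply (f' x)) (at x)"
    and "(f' has_derivative blinfun_apply (f'' x)) (at x)"
  using assms by (auto simp: C2_jet_def)

lemma C2_jet_continuous:
  assumes "C2_jet U f f' f''"
  shows "continuous_on U f" "continuous_on U f'" "continuous_on U f''"
proof -
  show "continuous_on U f" "continuous_on U f'"
    using C2_jetD[OF assms] has_derivative_continuous
    by (blast intro: continuous_at_imp_continuous_on)+
  show "continuous_on U f''" using assms by (simp add: C2_jet_def)
qed

lemma C2_jet_frechet:
  assumes "C2_jet U f f' f''" "x \<in> U"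
  shows "frechet_derivative f (at x) = blinfun_apply (f' x)"
  using frechet_derivative_at[OF C2_jetD(1)[OF assms]] by simp

lemma C2_jet_has_second_derivative:
  assumes "open U" "C2_jet U f f' f''" "x \<in> U"
  shows "((\<lambda>y. frechet_derivative f (at y) b) has_derivative (\<lambda>h. f'' x h b)) (at x)"
proof -
  have "((\<lambda>y. blinfun_apply (f' y) b) has_derivative (\<lambda>h. f'' x h b)) (at x)"
    using C2_jetD(2)[OF assms(2,3)] by (auto intro!: derivative_eq_intros simp: blinfun.bilinear_simps)
  thus ?thesis
    by (rule has_derivative_transform_within_open[OF _ assms(1,3)])
       (simp add: C2_jet_frechet[OF assms(2)])
qed

lemma laplacian_jet:
  assumes "open U" "C2_jet U f f' f''" "x \<in> U"
  shows "laplacian f x = (\<Sum>b\<in>Basis. f'' x b b)"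
  unfolding laplacian_def
  by (simp add: frechet_derivative_at[OF C2_jet_has_second_derivative[OF assms], symmetric])

lemma grad_inner_jet:
  assumes "C2_jet U f f' f''" "C2_jet U g g' g''" "x \<in> U"
  shows "grad_inner f g x = (\<Sum>b\<in>Basis. f' x b * g' x b)"
  by (simp add: grad_inner_def C2_jet_frechet[OF assms(1,3)] C2_jet_frechet[OF assms(2,3)])

lemma grad_inner_commute: "grad_inner f g x = grad_inner g f x"
  by (simp add: grad_inner_def mult.commute)

lemma C2_jet_cong:
  assumes "open U" "\<And>x. x \<in> U \<Longrightarrow> f x = g x" "C2_jet U f f' f''"
  shows "C2_jet U g f' f''"
proof -
  have "(g has_derivative blinfun_apply (f' x)) (at x)" if "x \<in> U" for x
    using has_derivative_transform_within_open[OF C2_jetD(1)[OF assms(3) that] assms(1) that] assms(2)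
    by blast
  thus ?thesis using assms(3) by (simp add: C2_jet_def)
qed

lemma C2_on_cong:
  assumes "open U" "\<And>x. x \<in> U \<Longrightarrow> f x = g x" "C2_on U f"
  shows "C2_on U g"
  using assms C2_jet_cong unfolding C2_on_iff_jet by blast

lemma laplacian_cong:
  assumes "open U" "\<And>x. x \<in> U \<Longrightarrow> f x = g x" "C2_on U f" "x \<in> U"
  shows "laplacian g x = laplacian f x"
proof -
  obtain f' f'' where f: "C2_jet U f f' f''" using assms(3) unfolding C2_on_iff_jet by blast
  have g: "C2_jet U g f' f''" by (rule C2_jet_cong[OF assms(1,2) f])
  show ?thesis
    by (simp add: laplacian_jet[OF assms(1) f assms(4)] laplacian_jet[OF assms(1) g assms(4)])
qed

lemma C2_on_subset: "C2_on U f \<Longrightarrow> V \<subseteq> U \<Longrightarrow> C2_on V f"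
  unfolding C2_on_iff_jet C2_jet_def by (blast intro: continuous_on_subset)

section \<open>Sums, products and compositions of twice differentiable functions\<close>

lemma C2_jet_linear:
  fixes l :: "'a::euclidean_space \<Rightarrow>\<^sub>L real"
  shows "C2_jet U (blinfun_apply l) (\<lambda>_. l) (\<lambda>_. 0)"
  by (auto simp: C2_jet_def zero_blinfun.rep_eq intro!: derivative_eq_intros
      bounded_linear_imp_has_derivative blinfun.bounded_linear_right)

lemma C2_jet_const: "C2_jet U (\<lambda>_. c) (\<lambda>_. 0) (\<lambda>_. 0)"
  by (auto simp: C2_jet_def zero_blinfun.rep_eq)

lemma C2_jet_add:
  assumes "C2_jet U f f' f''" "C2_jet U g g' g''"
  shows "C2_jet U (\<lambda>x. f x + g x) (\<lambda>x. f' x + g' x) (\<lambda>x. f'' x + g'' x)"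
  using assms
  by (auto simp: C2_jet_def plus_blinfun.rep_eq intro!: derivative_eq_intros continuous_intros)

lemma C2_jet_mult:
  assumes "C2_jet U f f' f''" "C2_jet U g g' g''"
  shows "C2_jet U (\<lambda>x. f x * g x) (\<lambda>x. f x *\<^sub>R g' x + g x *\<^sub>R f' x)
     (\<lambda>x. f x *\<^sub>R g'' x + (blinfun_scaleR_left (g' x) o\<^sub>L f' x)
        + (g x *\<^sub>R f'' x + (blinfun_scaleR_left (f' x) o\<^sub>L g' x)))"
proof -
  note c = C2_jet_continuous[OF assms(1)] C2_jet_continuous[OF assms(2)]
  note d = C2_jetD[OF assms(1)] C2_jetD[OF assms(2)]
  show ?thesis
    unfolding C2_jet_def
    apply (intro conjI ballI)
    subgoal by (auto intro!: derivative_eq_intros d simp: blinfun.bilinear_simps algebra_simps)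
    subgoal by (auto intro!: derivative_eq_intros d simp: blinfun.bilinear_simps algebra_simps)
    subgoal
      by (intro continuous_intros c bounded_linear.continuous_on[OF bounded_linear_blinfun_scaleR_left]
            bounded_bilinear.continuous_on[OF bounded_bilinear_blinfun_compose])
    done
qed

lemma C2_jet_compose:
  assumes "C2_jet U f f' f''"
    and "\<And>x. x \<in> U \<Longrightarrow> (\<phi> has_real_derivative \<phi>' (f x)) (at (f x))"
    and "\<And>x. x \<in> U \<Longrightarrow> (\<phi>' has_real_derivative \<phi>'' (f x)) (at (f x))"
    and "continuous_on (f ` U) \<phi>''"
  shows "C2_jet U (\<lambda>x. \<phi> (f x)) (\<lambda>x. \<phi>' (f x) *\<^sub>R f' x)
     (\<lambda>x. \<phi>' (f x) *\<^sub>R f'' x + \<phi>'' (f x) *\<^sub>R (blinfun_scaleR_left (f' x) o\<^sub>L f' x))"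
proof -
  note c = C2_jet_continuous[OF assms(1)]
  note d = C2_jetD[OF assms(1)]
  have d1: "((\<lambda>x. \<phi> (f x)) has_derivative (\<lambda>h. f' x h * \<phi>' (f x))) (at x)" if "x \<in> U" for x
    using has_derivative_compose[OF d(1)[OF that] assms(2)[OF that, THEN has_field_derivative_imp_has_derivative]]
    by (simp add: mult.commute)
  have d2: "((\<lambda>x. \<phi>' (f x)) has_derivative (\<lambda>h. f' x h * \<phi>'' (f x))) (at x)" if "x \<in> U" for x
    using has_derivative_compose[OF d(1)[OF that] assms(3)[OF that, THEN has_field_derivative_imp_has_derivative]]
    by (simp add: mult.commute)
  have c1: "continuous_on U (\<lambda>x. \<phi>' (f x))"
    using d2 has_derivative_continuous continuous_at_imp_continuous_on by blast
  have c2: "continuous_on U (\<lambda>x. \<phi>'' (f x))"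
    using continuous_on_compose2[OF assms(4) c(1)] by simp
  show ?thesis
    unfolding C2_jet_def
    apply (intro conjI ballI)
    subgoal for x using d1[of x] by (simp add: scaleR_blinfun.rep_eq mult.commute)
    subgoal for x by (auto intro!: derivative_eq_intros d d2 simp: blinfun.bilinear_simps algebra_simps)
    subgoal
      by (intro continuous_intros c c1 c2 bounded_linear.continuous_on[OF bounded_linear_blinfun_scaleR_left]
            bounded_bilinear.continuous_on[OF bounded_bilinear_blinfun_compose])
    done
qed

lemma C2_on_const [intro]: "C2_on U (\<lambda>_. c)"
  using C2_jet_const unfolding C2_on_iff_jet by blast

lemma C2_on_inner_left: "C2_on U (\<lambda>x. x \<bullet> a)"
  using C2_jet_linear[of U "blinfun_inner_left a"] unfolding C2_on_iff_jet
  by (auto simp: blinfun_inner_left.rep_eq[abs_def])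

lemma C2_on_add: "C2_on U f \<Longrightarrow> C2_on U g \<Longrightarrow> C2_on U (\<lambda>x. f x + g x)"
  using C2_jet_add unfolding C2_on_iff_jet by blast

lemma C2_on_mult: "C2_on U f \<Longrightarrow> C2_on U g \<Longrightarrow> C2_on U (\<lambda>x. f x * g x)"
  using C2_jet_mult unfolding C2_on_iff_jet by blast

lemma C2_on_cmult: "C2_on U f \<Longrightarrow> C2_on U (\<lambda>x. c * f x)"
  using C2_on_mult C2_on_const by blast

lemma C2_on_diff: "C2_on U f \<Longrightarrow> C2_on U g \<Longrightarrow> C2_on U (\<lambda>x. f x - g x)"
  using C2_on_add[OF _ C2_on_cmult[of U g "-1"], of f] by simp

lemma C2_on_compose:
  assumes "C2_on U f"
    and "\<And>x. x \<in> U \<Longrightarrow> (\<phi> has_real_derivative \<phi>' (f x)) (at (f x))"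
    and "\<And>x. x \<in> U \<Longrightarrow> (\<phi>' has_real_derivative \<phi>'' (f x)) (at (f x))"
    and "continuous_on (f ` U) \<phi>''"
  shows "C2_on U (\<lambda>x. \<phi> (f x))"
  using C2_jet_compose[OF _ assms(2,3,4)] assms(1) unfolding C2_on_iff_jet by blast

section \<open>Product and chain rules for the Laplacian\<close>

context
  fixes U :: "'a::euclidean_space set" and x :: 'a
  assumes U: "open U" "x \<in> U"
begin

lemma laplacian_const [simp]: "laplacian (\<lambda>_. c) x = 0"
  using laplacian_jet[OF U(1) C2_jet_const U(2)] by simp

lemma grad_inner_const [simp]: "grad_inner f (\<lambda>_. c) x = 0" "grad_inner (\<lambda>_. c) f x = 0"
  by (simp_all add: grad_inner_def)

lemma laplacian_inner_left: "laplacian (\<lambda>x. x \<bullet> a) x = 0"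
  using laplacian_jet[OF U(1) C2_jet_linear[of U "blinfun_inner_left a"] U(2)]
  by (simp add: blinfun_inner_left.rep_eq[abs_def])

lemma grad_inner_inner_left: "grad_inner (\<lambda>x. x \<bullet> a) (\<lambda>x. x \<bullet> b) x = a \<bullet> b"
  using grad_inner_jet[OF C2_jet_linear[of U "blinfun_inner_left a"]
      C2_jet_linear[of U "blinfun_inner_left b"] U(2)]
  by (simp add: blinfun_inner_left.rep_eq[abs_def] euclidean_inner[of a b] inner_commute)

lemma laplacian_add:
  assumes "C2_on U f" "C2_on U g"
  shows "laplacian (\<lambda>x. f x + g x) x = laplacian f x + laplacian g x"
proof -
  obtain f' f'' g' g'' where *: "C2_jet U f f' f''" "C2_jet U g g' g''"
    using assms unfolding C2_on_iff_jet by blast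
  show ?thesis
    using laplacian_jet[OF U(1) C2_jet_add[OF *] U(2)] laplacian_jet[OF U(1) *(1) U(2)]
      laplacian_jet[OF U(1) *(2) U(2)]
    by (simp add: blinfun.bilinear_simps sum.distrib)
qed

lemma grad_inner_add:
  assumes "C2_on U h" "C2_on U f" "C2_on U g"
  shows "grad_inner h (\<lambda>x. f x + g x) x = grad_inner h f x + grad_inner h g x"
proof -
  obtain f' f'' g' g'' h' h'' where
    *: "C2_jet U f f' f''" "C2_jet U g g' g''" "C2_jet U h h' h''"
    using assms unfolding C2_on_iff_jet by blast
  show ?thesis
    using grad_inner_jet[OF *(3) C2_jet_add[OF *(1,2)] U(2)] grad_inner_jet[OF *(3,1) U(2)]
      grad_inner_jet[OF *(3,2) U(2)]
    by (simp add: blinfun.bilinear_simps sum.distrib distrib_left)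
qed

lemma laplacian_mult:
  assumes "C2_on U f" "C2_on U g"
  shows "laplacian (\<lambda>x. f x * g x) x =
    f x * laplacian g x + g x * laplacian f x + 2 * grad_inner f g x"
proof -
  obtain f' f'' g' g'' where *: "C2_jet U f f' f''" "C2_jet U g g' g''"
    using assms unfolding C2_on_iff_jet by blast
  show ?thesis
    using laplacian_jet[OF U(1) C2_jet_mult[OF *] U(2)] laplacian_jet[OF U(1) *(1) U(2)]
      laplacian_jet[OF U(1) *(2) U(2)] grad_inner_jet[OF * U(2)]
    by (simp add: blinfun.bilinear_simps sum.distrib sum_distrib_left algebra_simps)
qed

lemma grad_inner_mult:
  assumes "C2_on U h" "C2_on U f" "C2_on U g"
  shows "grad_inner h (\<lambda>x. f x * g x) x = f x * grad_inner h g x + g x * grad_inner h f x"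
proof -
  obtain f' f'' g' g'' h' h'' where
    *: "C2_jet U f f' f''" "C2_jet U g g' g''" "C2_jet U h h' h''"
    using assms unfolding C2_on_iff_jet by blast
  show ?thesis
    using grad_inner_jet[OF *(3) C2_jet_mult[OF *(1,2)] U(2)] grad_inner_jet[OF *(3,1) U(2)]
      grad_inner_jet[OF *(3,2) U(2)]
    by (simp add: blinfun.bilinear_simps sum.distrib sum_distrib_left algebra_simps)
qed

lemma laplacian_cmult: "C2_on U f \<Longrightarrow> laplacian (\<lambda>x. c * f x) x = c * laplacian f x"
  by (subst laplacian_mult) auto

lemma grad_inner_cmult:
  "C2_on U h \<Longrightarrow> C2_on U f \<Longrightarrow> grad_inner h (\<lambda>x. c * f x) x = c * grad_inner h f x"
  by (subst grad_inner_mult) auto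

lemma laplacian_diff:
  assumes "C2_on U f" "C2_on U g"
  shows "laplacian (\<lambda>x. f x - g x) x = laplacian f x - laplacian g x"
  using laplacian_add[OF assms(1) C2_on_cmult[OF assms(2), of "-1"]] laplacian_cmult[OF assms(2), of "-1"]
  by simp

lemma grad_inner_diff:
  assumes "C2_on U h" "C2_on U f" "C2_on U g"
  shows "grad_inner h (\<lambda>x. f x - g x) x = grad_inner h f x - grad_inner h g x"
  using grad_inner_add[OF assms(1,2) C2_on_cmult[OF assms(3), of "-1"]]
    grad_inner_cmult[OF assms(1,3), of "-1"]
  by simp

lemma laplacian_compose:
  assumes "C2_on U f"
    and "\<And>x. x \<in> U \<Longrightarrow> (\<phi> has_real_derivative \<phi>' (f x)) (at (f x))"
    and "\<And>x. x \<in> U \<Longrightarrow> (\<phi>' has_real_derivative \<phi>'' (f x)) (at (f x))"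
    and "continuous_on (f ` U) \<phi>''"
  shows "laplacian (\<lambda>x. \<phi> (f x)) x = \<phi>' (f x) * laplacian f x + \<phi>'' (f x) * grad_inner f f x"
proof -
  obtain f' f'' where *: "C2_jet U f f' f''"
    using assms(1) unfolding C2_on_iff_jet by blast
  show ?thesis
    using laplacian_jet[OF U(1) C2_jet_compose[OF * assms(2,3,4)] U(2)]
      laplacian_jet[OF U(1) * U(2)] grad_inner_jet[OF * * U(2)]
    by (simp add: blinfun.bilinear_simps sum.distrib sum_distrib_left algebra_simps)
qed

lemma grad_inner_compose:
  assumes "C2_on U h" "C2_on U f"
    and "\<And>x. x \<in> U \<Longrightarrow> (\<phi> has_real_derivative \<phi>' (f x)) (at (f x))"
    and "\<And>x. x \<in> U \<Longrightarrow> (\<phi>' has_real_derivative \<phi>'' (f x)) (at (f x))"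
    and "continuous_on (f ` U) \<phi>''"
  shows "grad_inner h (\<lambda>x. \<phi> (f x)) x = \<phi>' (f x) * grad_inner h f x"
proof -
  obtain f' f'' h' h'' where *: "C2_jet U f f' f''" "C2_jet U h h' h''"
    using assms(1,2) unfolding C2_on_iff_jet by blast
  show ?thesis
    using grad_inner_jet[OF *(2) C2_jet_compose[OF *(1) assms(3,4,5)] U(2)]
      grad_inner_jet[OF *(2,1) U(2)]
    by (simp add: blinfun.bilinear_simps sum_distrib_left algebra_simps)
qed

end

text \<open>Tested on lines through \<open>x\<close>: if the second derivative in direction
  \<open>b\<close> were positive, \<open>g'\<close> would be 0 at the origin and positive just to
  its right, and the mean value theorem would produce a value above the maximum.\<close>

lemma laplacian_nonpos_at_max:
  assumes U: "open U" "x \<in> U" and f: "C2_on U f" and max: "\<And>y. y \<in> U \<Longrightarrow> f y \<le> f x"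
  shows "laplacian f x \<le> 0"
proof -
  obtain f' f'' where j: "C2_jet U f f' f''" using f unfolding C2_on_iff_jet by blast
  have "f'' x b b \<le> 0" for b
  proof (rule ccontr)
    assume "\<not> f'' x b b \<le> 0"
    hence pos: "0 < f'' x b b" by simp
    define g where "g s = f (x + s *\<^sub>R b)" for s :: real
    define g' where "g' s = f' (x + s *\<^sub>R b) b" for s :: real
    have dg: "(g has_real_derivative g' s) (at s)" if "x + s *\<^sub>R b \<in> U" for s
    proof -
      have "((\<lambda>s. x + s *\<^sub>R b) has_derivative (\<lambda>h. h *\<^sub>R b)) (at s)"
        by (auto intro!: derivative_eq_intros)
      from has_derivative_compose[OF this C2_jetD(1)[OF j that]]
      show ?thesis
        unfolding g_def g'_def has_field_derivative_def
        by (rule has_derivative_eq_rhs) (auto simp: blinfun.bilinear_simps mult.commute)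
    qed
    have dg': "(g' has_real_derivative f'' x b b) (at 0)"
    proof -
      have "((\<lambda>s. x + s *\<^sub>R b) has_derivative (\<lambda>h. h *\<^sub>R b)) (at 0)"
        by (auto intro!: derivative_eq_intros)
      from has_derivative_compose[OF this, of f' "f'' x"] C2_jetD(2)[OF j U(2)]
      have "((\<lambda>s. f' (x + s *\<^sub>R b)) has_derivative (\<lambda>h. f'' x (h *\<^sub>R b))) (at 0)" by simp
      hence "((\<lambda>s. f' (x + s *\<^sub>R b) b) has_derivative (\<lambda>h. f'' x (h *\<^sub>R b) b)) (at 0)"
        by (auto intro!: derivative_eq_intros simp: blinfun.bilinear_simps)
      thus ?thesis
        unfolding g'_def has_field_derivative_def
        by (rule has_derivative_eq_rhs) (auto simp: blinfun.bilinear_simps mult.commute)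
    qed
    have "open ((\<lambda>s::real. x + s *\<^sub>R b) -` U)"
      by (intro open_vimage U continuous_intros)
    moreover have "0 \<in> (\<lambda>s::real. x + s *\<^sub>R b) -` U" using U by simp
    ultimately obtain d where "d > 0" "ball 0 d \<subseteq> (\<lambda>s::real. x + s *\<^sub>R b) -` U"
      using openE by blast
    hence d: "d > 0" "\<And>s. \<bar>s\<bar> < d \<Longrightarrow> x + s *\<^sub>R b \<in> U" by (auto simp: subset_iff)
    have "g' 0 = 0"
    proof (rule DERIV_local_max)
      show "(g has_real_derivative g' 0) (at 0)" using dg[of 0] U by simp
      show "\<forall>y. \<bar>0 - y\<bar> < d \<longrightarrow> g y \<le> g 0" using max d by (simp add: g_def)
    qed (fact d)
    obtain e where e: "e > 0" "\<And>h. 0 < h \<Longrightarrow> h < e \<Longrightarrow> g' 0 < g' (0 + h)"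
      using DERIV_pos_inc_right[OF dg' pos] by blast
    define s where "s = min d e / 2"
    have s: "0 < s" "s < d" "s < e" using d e by (auto simp: s_def)
    obtain z where z: "0 < z" "z < s" "g s - g 0 = (s - 0) * g' z"
    proof -
      have "(g has_real_derivative g' t) (at t)" if "0 \<le> t" "t \<le> s" for t
        by (rule dg) (use that s in \<open>auto intro: d\<close>)
      from MVT2[OF s(1) this] that show ?thesis by blast
    qed
    have "g' z > 0" using e(2)[of z] z s \<open>g' 0 = 0\<close> by simp
    hence "g s > g 0" using z s by (smt (verit) mult_pos_pos)
    thus False using max[of "x + s *\<^sub>R b"] d(2)[of s] s by (simp add: g_def)
  qed
  thus ?thesis unfolding laplacian_jet[OF U(1) j U(2)] by (intro sum_nonpos)
qed

text \<open>The gradient field is composed with \<open>sgn\<close> once more before it is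
  differentiated, and the derivative of \<open>sgn\<close> at a unit vector is the tangential
  projection. This leaves the trace of the Hessian minus its value on the pair \<open>x\<close>,
  \<open>x\<close>, which is zero because \<open>u \<circ> sgn\<close> is constant along the
  ray.\<close>

lemma laplace_beltrami_eq_laplacian:
  fixes M :: "'a::euclidean_space set"
  assumes op: "open (sgn -` M)" and M: "M \<subseteq> sphere 0 1" and x: "x \<in> M"
    and C2: "C2_on (sgn -` M) (u \<circ> sgn)"
  shows "laplace_beltrami u x = laplacian (u \<circ> sgn) x"
proof -
  let ?U = "sgn -` M" and ?V = "u \<circ> sgn"
  obtain f' f'' where j: "C2_jet ?U ?V f' f''" using C2 unfolding C2_on_iff_jet by blast
  have nx: "norm x = 1" using M x by auto
  hence sx: "sgn x = x" by (simp add: sgn_div_norm)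
  hence xU: "x \<in> ?U" using x by simp
  define G where "G y = (\<Sum>b\<in>Basis. f' y b *\<^sub>R b)" for y
  have sg: "(sphere_grad u \<circ> sgn) y = G (sgn y)" if "y \<in> ?U" for y
  proof -
    have "sgn (sgn y) = sgn y" by (cases "y = 0") (simp_all add: sgn_div_norm)
    hence "sgn y \<in> ?U" using that by simp
    thus ?thesis by (simp add: sphere_grad_def G_def C2_jet_frechet[OF j])
  qed
  have dG: "(G has_derivative (\<lambda>h. \<Sum>b\<in>Basis. f'' x h b *\<^sub>R b)) (at (sgn x))"
    unfolding G_def sx using C2_jetD(2)[OF j xU]
    by (auto intro!: derivative_eq_intros simp: blinfun.bilinear_simps)
  have x0: "x \<noteq> 0" using nx by auto
  have dsgn: "(sgn has_derivative (\<lambda>h. h - (x \<bullet> h) *\<^sub>R x)) (at x)"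
  proof -
    have *: "(norm has_derivative (\<lambda>h. x \<bullet> h)) (at x)"
      using has_derivative_norm[OF x0] sx by (simp add: inner_commute)
    have "((\<lambda>y. inverse (norm y) *\<^sub>R y) has_derivative (\<lambda>h. h - (x \<bullet> h) *\<^sub>R x)) (at x)"
      using nx x0 by (auto intro!: derivative_eq_intros *)
    thus ?thesis by (simp add: sgn_div_norm[abs_def])
  qed
  define D where "D h = (\<Sum>b\<in>Basis. f'' x (h - (x \<bullet> h) *\<^sub>R x) b *\<^sub>R b)" for h
  have "((\<lambda>y. G (sgn y)) has_derivative D) (at x)"
    using has_derivative_compose[OF dsgn dG] unfolding D_def .
  hence "((sphere_grad u \<circ> sgn) has_derivative D) (at x)"
    by (rule has_derivative_transform_within_open[OF _ op xU]) (use sg in auto)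
  hence fd: "frechet_derivative (sphere_grad u \<circ> sgn) (at x) = D"
    by (rule frechet_derivative_at[symmetric])
  \<comment> \<open>Euler's relation \<open>f' y y = 0\<close> for functions homogeneous of degree
    0, differentiated along the ray through \<open>x\<close>.\<close>
  have radial: "f'' x x x = 0"
  proof -
    have f'0: "f' y y = 0" if "y \<in> ?U" "y \<noteq> 0" for y
    proof -
      have "((\<lambda>s. s *\<^sub>R y) has_derivative (\<lambda>h. h *\<^sub>R y)) (at (1::real))"
        by (auto intro!: derivative_eq_intros)
      from has_derivative_compose[OF this, of ?V "f' y"] C2_jetD(1)[OF j that(1)]
      have "((\<lambda>s. ?V (s *\<^sub>R y)) has_derivative (\<lambda>h. f' y (h *\<^sub>R y))) (at (1::real))" by simp
      hence "((\<lambda>s. ?V y) has_derivative (\<lambda>h. f' y (h *\<^sub>R y))) (at (1::real))"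
        by (rule has_derivative_transform_within_open[of _ _ _ _ "{0<..}"]) (auto simp: sgn_scaleR)
      from has_derivative_unique[OF this has_derivative_const]
      have "f' y (1 *\<^sub>R y) = 0" by (rule fun_cong)
      thus ?thesis by simp
    qed
    have 1: "((\<lambda>s. s *\<^sub>R x) has_derivative (\<lambda>h. h *\<^sub>R x)) (at (1::real))"
      by (auto intro!: derivative_eq_intros)
    from has_derivative_compose[OF 1, of f' "f'' x"] C2_jetD(2)[OF j xU]
    have "((\<lambda>s. f' (s *\<^sub>R x)) has_derivative (\<lambda>h. f'' x (h *\<^sub>R x))) (at (1::real))" by simp
    hence rd: "((\<lambda>s. f' (s *\<^sub>R x) x) has_derivative (\<lambda>h. f'' x (h *\<^sub>R x) x)) (at (1::real))"
      by (auto intro!: derivative_eq_intros simp: blinfun.bilinear_simps)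
    have r0: "f' (s *\<^sub>R x) x = 0" if "s > 0" for s
    proof -
      have "s *\<^sub>R x \<in> ?U" using that x sx by (simp add: sgn_scaleR)
      from f'0[OF this] show ?thesis using that x0 by (simp add: blinfun.bilinear_simps)
    qed
    have "((\<lambda>s. 0) has_derivative (\<lambda>h. f'' x (h *\<^sub>R x) x)) (at (1::real))"
      by (rule has_derivative_transform_within_open[OF rd, of "{0<..}"]) (simp_all add: r0)
    from has_derivative_unique[OF this has_derivative_const]
    have "f'' x (1 *\<^sub>R x) x = 0" by (rule fun_cong)
    thus ?thesis by simp
  qed
  have "D b \<bullet> b = f'' x b b - (x \<bullet> b) * f'' x x b" if "b \<in> Basis" for b
    using that by (simp add: D_def inner_sum_left inner_Basis blinfun.bilinear_simps if_distrib
        cong: if_cong)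
  hence "laplace_beltrami u x = (\<Sum>b\<in>Basis. f'' x b b) - (\<Sum>b\<in>Basis. (x \<bullet> b) * f'' x x b)"
    by (simp add: laplace_beltrami_def sphere_div_def fd sum_subtractf)
  also have "(\<Sum>b\<in>Basis. (x \<bullet> b) * f'' x x b) = f'' x x (\<Sum>b\<in>Basis. (x \<bullet> b) *\<^sub>R b)"
    by (simp add: blinfun.sum_right blinfun.bilinear_simps)
  also have "\<dots> = 0" by (simp add: euclidean_representation radial)
  finally show ?thesis by (simp add: laplacian_jet[OF op j xU])
qed

subsection \<open>Gegenbauer polynomials\<close>

text \<open>
  By Rodrigues' formula this is, up to a factor, the \<open>n\<close>-th derivative of the Legendre polynomial of
  degree \<open>n + j\<close>.
\<close>

definition gegenbauer :: "nat \<Rightarrow> nat \<Rightarrow> real poly" where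
  "gegenbauer n j = (pderiv ^^ (2 * n + j)) ([:-1, 0, 1:] ^ (n + j))"

text \<open>The power \<open>w 0\<close> satisfies the first-order equation (t^2 - 1) w' = 2 l t w.
  Its derivative is the case \<open>k = 0\<close>, and every further differentiation raises
  \<open>k\<close> by one.\<close>

lemma pderiv_iterate_ode:
  fixes l k :: nat
  defines "w \<equiv> (\<lambda>k. (pderiv ^^ k) ([:-1, 0, 1:] ^ l :: real poly))"
  shows "[:-1, 0, 1:] * w (Suc (Suc k)) + [:0, 2 - 2 * real l + 2 * real k:] * w (Suc k)
           + smult ((real k + 1) * (real k - 2 * real l)) (w k) = 0"
proof (induction k)
  case 0
  have "[:-1, 0, 1:] * w 1 = [:0, 2 * real l:] * w 0"
  proof (cases l)
    case (Suc i)
    define A :: "real poly" where "A = [:-1, 0, 1:]"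
    have "pderiv A = [:0, 2:]" by (simp add: A_def pderiv_pCons)
    hence "A * pderiv (A ^ Suc i) = smult (1 + real i) [:0, 2:] * A ^ Suc i"
      by (subst pderiv_power_Suc) (simp only: power_Suc mult_smult_left mult_smult_right mult_ac of_nat_Suc)
    also have "smult (1 + real i) [:0, 2:] = [:0, 2 * real l:]" by (simp add: Suc)
    finally show ?thesis by (simp only: w_def A_def[symmetric] Suc) simp
  qed (simp add: w_def)
  hence "pderiv ([:-1, 0, 1:] * w 1) = pderiv ([:0, 2 * real l:] * w 0)" by simp
  moreover have "[:c:] * q = smult c q" for c and q :: "real poly" by simp
  ultimately have "[:-1, 0, 1:] * w 2 + [:0, 2:] * w 1 = [:0, 2 * real l:] * w 1 + smult (2 * real l) (w 0)"
    by (simp add: pderiv_mult w_def numeral_2_eq_2 pderiv_pCons algebra_simps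
        del: mult_pCons_left mult_pCons_right)
  hence "[:-1, 0, 1:] * w 2 + ([:0, 2:] - [:0, 2 * real l:]) * w 1 - smult (2 * real l) (w 0) = 0"
    by (simp only: left_diff_distrib)
  thus ?case by (simp add: numeral_2_eq_2)
next
  case (Suc k)
  let ?a = "2 - 2 * real l + 2 * real k" and ?b = "(real k + 1) * (real k - 2 * real l)"
  have "pderiv ([:-1, 0, 1:] * w (Suc (Suc k)) + [:0, ?a:] * w (Suc k) + smult ?b (w k)) = 0"
    using Suc.IH by simp
  moreover have "pderiv ([:-1, 0, 1:] * P) = [:-1, 0, 1:] * pderiv P + [:0, 2:] * P" for P :: "real poly"
    by (subst pderiv_mult) (simp add: pderiv_pCons)
  moreover have "pderiv ([:0, c:] * P) = [:0, c:] * pderiv P + smult c P" for c and P :: "real poly"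
    by (subst pderiv_mult) (simp add: pderiv_pCons)
  moreover have "pderiv (w i) = w (Suc i)" for i by (simp add: w_def)
  ultimately have "[:-1, 0, 1:] * w (Suc (Suc (Suc k))) + [:0, 2:] * w (Suc (Suc k))
      + ([:0, ?a:] * w (Suc (Suc k)) + smult ?a (w (Suc k))) + smult ?b (w (Suc k)) = 0"
    by (simp only: pderiv_add pderiv_smult)
  hence "[:-1, 0, 1:] * w (Suc (Suc (Suc k))) + ([:0, 2:] + [:0, ?a:]) * w (Suc (Suc k))
      + smult (?a + ?b) (w (Suc k)) = 0"
    by (simp only: distrib_right smult_add_left add.assoc)
  moreover have "[:0, 2:] + [:0, ?a:] = [:0, 2 - 2 * real l + 2 * real (Suc k):]" by simp
  moreover have "?a + ?b = (real (Suc k) + 1) * (real (Suc k) - 2 * real l)"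
    by (simp add: algebra_simps)
  ultimately show ?case by (simp only:)
qed

text \<open>The case \<open>l = n + j\<close>, \<open>k = 2 * n + j\<close> of the preceding
  equation, with the sign reversed. It is the equation in x_1 that separation of variables leaves
  for angular frequency \<open>n\<close>.\<close>

lemma gegenbauer_ode:
  "[:1, 0, -1:] * pderiv (pderiv (gegenbauer n j)) - [:0, 2 * (real n + 1):] * pderiv (gegenbauer n j)
     + smult (real j * (real j + 2 * real n + 1)) (gegenbauer n j) = 0"
proof -
  have neg: "[:1, 0, -1:] * X - [:0, a:] * Y + smult c Z
      = - ([:-1, 0, 1:] * X + [:0, a:] * Y + smult (- c) Z)" for X Y Z :: "real poly" and a c
  proof -
    have "[:1, 0, -1::real:] = - [:-1, 0, 1:]" by simp
    thus ?thesis by (simp only: mult_minus_left smult_minus_left minus_add_distrib minus_minus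
          diff_conv_add_uminus)
  qed
  have "real (2 * n + j) - 2 * real (n + j) = - real j"
    "2 - 2 * real (n + j) + 2 * real (2 * n + j) = 2 * (real n + 1)" by simp_all
  hence "[:-1, 0, 1:] * pderiv (pderiv (gegenbauer n j)) + [:0, 2 * (real n + 1):] * pderiv (gegenbauer n j)
     + smult (- (real j * (real j + 2 * real n + 1))) (gegenbauer n j) = 0"
    using pderiv_iterate_ode[where l = "n + j" and k = "2 * n + j"]
    by (simp add: gegenbauer_def algebra_simps del: mult_pCons_left)
  thus ?thesis unfolding neg by simp
qed

lemma degree_pderiv_iterate:
  fixes q :: "real poly"
  shows "degree ((pderiv ^^ k) q) = degree q - k"
  by (induction k) (simp_all add: degree_pderiv)

lemma degree_gegenbauer: "degree (gegenbauer n j) = j"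
  by (simp add: gegenbauer_def degree_pderiv_iterate degree_power_eq)

lemma gegenbauer_nonzero: "gegenbauer n j \<noteq> 0"
proof (cases "j = 0")
  case False
  thus ?thesis using degree_gegenbauer[of n j] by auto
next
  \<comment> \<open>A degree of 0 does not tell a nonzero constant from the zero polynomial, so here
    the derivatives are counted instead.\<close>
  case True
  have "(pderiv ^^ k) q \<noteq> 0" if "k \<le> degree q" "q \<noteq> 0" for k and q :: "real poly"
    using that
  proof (induction k)
    case (Suc k)
    hence "degree ((pderiv ^^ k) q) \<noteq> 0" by (simp add: degree_pderiv_iterate)
    thus ?case by (simp add: pderiv_eq_0_iff)
  qed simp
  thus ?thesis by (simp add: gegenbauer_def True degree_power_eq)
qed

text \<open>There is one polynomial of each degree, so cancelling the leading coefficient lowers the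
  degree.\<close>

lemma poly_eq_sum_gegenbauer:
  fixes q :: "real poly"
  assumes "degree q < d"
  shows "\<exists>c. q = (\<Sum>j<d. smult (c j) (gegenbauer n j))"
  using assms
proof (induction d arbitrary: q)
  case (Suc d)
  let ?G = "gegenbauer n"
  define a where "a = coeff q d / coeff (?G d) d"
  have lc: "coeff (?G d) d \<noteq> 0"
    using gegenbauer_nonzero[of n d] degree_gegenbauer[of n d] leading_coeff_neq_0 by metis
  define r where "r = q - smult a (?G d)"
  have r0: "coeff r i = 0" if "i \<ge> d" for i
  proof (cases "i = d")
    case True thus ?thesis using lc by (simp add: r_def a_def)
  next
    case False
    thus ?thesis using that Suc.prems by (simp add: r_def coeff_eq_0 degree_gegenbauer)
  qed
  show ?case
  \<comment> \<open>For \<open>d = 0\<close> the remainder is zero, but its degree is the natural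
    number 0 and not below \<open>d\<close>.\<close>
  proof (cases "d = 0")
    case True
    hence "r = 0" using r0 by (intro poly_eqI) simp
    thus ?thesis using True by (intro exI[of _ "\<lambda>_. a"]) (simp add: r_def)
  next
    case False
    have "degree r \<le> d - 1" using r0 by (intro degree_le) auto
    hence "degree r < d" using False by simp
    then obtain c where c: "r = (\<Sum>j<d. smult (c j) (?G j))" using Suc.IH by blast
    have "q = (\<Sum>j<Suc d. smult ((c(d := a)) j) (?G j))"
      using c by (simp add: r_def algebra_simps)
    thus ?thesis by blast
  qed
qed simp

text \<open>Sturm--Liouville: \<open>F\<close> is the Wronskian with the factor
  \<open>(1 - t\<^sup>2) ^ Suc n\<close>. It vanishes at both end points, and the differential
  equation makes its derivative the integrand times the difference of the two eigenvalues
  \<open>\<kappa>\<close>.\<close>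

lemma gegenbauer_orthogonal:
  assumes "i \<noteq> j"
  shows "integral {-1..1} (\<lambda>t. poly (gegenbauer n i) t * poly (gegenbauer n j) t * (1 - t\<^sup>2) ^ n) = 0"
proof -
  define P Q where "P = gegenbauer n i" and "Q = gegenbauer n j"
  define \<kappa> where "\<kappa> = (\<lambda>k::nat. real k * (real k + 2 * real n + 1))"
  define F where "F t = (1 - t\<^sup>2) ^ Suc n *
    (poly (pderiv P) t * poly Q t - poly P t * poly (pderiv Q) t)" for t
  have ode: "(1 - t\<^sup>2) * poly (pderiv (pderiv (gegenbauer n k))) t =
      2 * (real n + 1) * t * poly (pderiv (gegenbauer n k)) t - \<kappa> k * poly (gegenbauer n k) t" for k t
    using arg_cong[OF gegenbauer_ode[of n k], of "\<lambda>q. poly q t"]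
    by (simp add: \<kappa>_def power2_eq_square algebra_simps)
  have dF: "(F has_real_derivative (\<kappa> j - \<kappa> i) * (poly P t * poly Q t * (1 - t\<^sup>2) ^ n)) (at t)" for t
  proof -
    define p0 p1 p2 q0 q1 q2 where d: "p0 = poly P t" "p1 = poly (pderiv P) t"
      "p2 = poly (pderiv (pderiv P)) t" "q0 = poly Q t" "q1 = poly (pderiv Q) t"
      "q2 = poly (pderiv (pderiv Q)) t"
    have dW: "((\<lambda>t. (1 - t\<^sup>2) ^ Suc n) has_real_derivative
        (real n + 1) * (1 - t\<^sup>2) ^ n * (- 2 * t)) (at t)"
      by (rule DERIV_cong[OF DERIV_power_Suc[of "\<lambda>t. 1 - t\<^sup>2" "- 2 * t"]])
         (auto intro!: derivative_eq_intros)
    have "(F has_real_derivative ((real n + 1) * (1 - t\<^sup>2) ^ n * (- 2 * t) * (p1 * q0 - p0 * q1)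
        + (1 - t\<^sup>2) ^ Suc n * (p2 * q0 - p0 * q2))) (at t)"
      unfolding F_def d
      by (rule DERIV_cong[OF DERIV_mult[OF dW DERIV_diff[OF
            DERIV_mult[OF poly_DERIV poly_DERIV] DERIV_mult[OF poly_DERIV poly_DERIV]]]])
         (simp add: algebra_simps)
    moreover have "(1 - t\<^sup>2) ^ Suc n * (p2 * q0 - p0 * q2)
        = (1 - t\<^sup>2) ^ n * (((1 - t\<^sup>2) * p2) * q0 - p0 * ((1 - t\<^sup>2) * q2))"
      by (simp add: algebra_simps)
    moreover have "(1 - t\<^sup>2) * p2 = 2 * (real n + 1) * t * p1 - \<kappa> i * p0"
      "(1 - t\<^sup>2) * q2 = 2 * (real n + 1) * t * q1 - \<kappa> j * q0"
      using ode unfolding d P_def Q_def by blast+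
    ultimately have "(F has_real_derivative ((real n + 1) * (1 - t\<^sup>2) ^ n * (- 2 * t) * (p1 * q0 - p0 * q1)
        + (1 - t\<^sup>2) ^ n * ((2 * (real n + 1) * t * p1 - \<kappa> i * p0) * q0
            - p0 * (2 * (real n + 1) * t * q1 - \<kappa> j * q0)))) (at t)"
      by (simp only:)
    thus ?thesis unfolding d[symmetric] by (rule DERIV_cong) (simp add: algebra_simps)
  qed
  have "((\<lambda>t. (\<kappa> j - \<kappa> i) * (poly P t * poly Q t * (1 - t\<^sup>2) ^ n)) has_integral (F 1 - F (-1))) {-1..1}"
  proof (rule fundamental_theorem_of_calculus)
    fix t
    show "(F has_vector_derivative (\<kappa> j - \<kappa> i) * (poly P t * poly Q t * (1 - t\<^sup>2) ^ n)) (at t within {-1..1})"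
      using has_field_derivative_at_within[OF dF]
      unfolding has_real_derivative_iff_has_vector_derivative .
  qed simp
  hence "(\<kappa> j - \<kappa> i) * integral {-1..1} (\<lambda>t. poly P t * poly Q t * (1 - t\<^sup>2) ^ n) = 0"
    by (simp add: F_def has_integral_iff)
  moreover have "\<kappa> j \<noteq> \<kappa> i"
  proof -
    have "\<kappa> j - \<kappa> i = (real j - real i) * (real i + real j + 2 * real n + 1)"
      by (simp add: \<kappa>_def algebra_simps)
    thus ?thesis using assms by auto
  qed
  ultimately show ?thesis by (simp add: P_def Q_def)
qed

subsection \<open>The volume of the wedge\<close>

text \<open>Angles are measured from the third axis towards the second, as in \<open>wedge\<close>;
  with this orientation the map adds \<open>b\<close> to the angle.\<close>

definition rot :: "real \<Rightarrow> real ^ 3 \<Rightarrow> real ^ 3" where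
  "rot b x = vector [x $ 1, cos b * x $ 2 + sin b * x $ 3, cos b * x $ 3 - sin b * x $ 2]"

lemma rot_nth [simp]:
  "rot b x $ 1 = x $ 1" "rot b x $ 2 = cos b * x $ 2 + sin b * x $ 3"
  "rot b x $ 3 = cos b * x $ 3 - sin b * x $ 2"
  by (simp_all add: rot_def vector_3)

lemma orthogonal_transformation_rot: "orthogonal_transformation (rot b)"
  unfolding orthogonal_transformation_def
proof (intro conjI allI)
  show "linear (rot b)"
    by (rule linearI) (simp_all add: vec_eq_iff forall_3 algebra_simps)
  fix v w
  have *: "rot b v \<bullet> rot b w = v $ 1 * w $ 1 + ((sin b)\<^sup>2 + (cos b)\<^sup>2) * (v $ 2 * w $ 2 + v $ 3 * w $ 3)"
    unfolding inner_vec_def sum_3 rot_nth inner_real_def power2_eq_square by algebra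
  show "rot b v \<bullet> rot b w = v \<bullet> w"
    unfolding * sin_cos_squared_add by (simp add: inner_vec_def sum_3)
qed

text \<open>Here \<open>b\<close> is half the opening angle, so \<open>2 * p\<close> wedges of angle
  \<open>2 * b\<close> make a full turn.\<close>

locale wedge_geometry =
  fixes p :: nat and b :: real
  assumes p: "p \<ge> 1" and b_def: "b = pi / (2 * real p)"
begin

lemma half_angle: "0 < b" "b \<le> pi / 2"
  using p by (simp_all add: b_def field_simps)

lemma sgn_vimage_wedge:
  "sgn -` wedge p = {x. x $ 3 > 0 \<and> (\<exists>\<phi>\<in>{- b<..<b}. x $ 2 = x $ 3 * tan \<phi>)}"
proof -
  have "sgn x \<in> wedge p \<longleftrightarrow> x $ 3 > 0 \<and> (\<exists>\<phi>\<in>{- b<..<b}. x $ 2 = x $ 3 * tan \<phi>)"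
    for x :: "real ^ 3"
  proof (cases "x = 0")
    case False
    have "- pi / (2 * real p) = - b" by (simp add: b_def)
    thus ?thesis using False
      by (simp add: wedge_def sgn_div_norm zero_less_mult_iff norm_sgn flip: b_def)
  qed (simp add: wedge_def)
  thus ?thesis by auto
qed

text \<open>The existential over \<phi> is traded for a condition on the continuous function
  \<open>arctan (x $ 2 / x $ 3)\<close>; as \<open>b \<le> pi / 2\<close>, \<open>arctan\<close>
  inverts \<open>tan\<close> on the whole range of angles.\<close>

lemma open_sgn_vimage_wedge: "open (sgn -` wedge p)"
proof -
  have arc: "arctan (tan \<phi>) = \<phi>" if "\<phi> \<in> {- b<..<b}" for \<phi>
    using that half_angle by (intro arctan_tan) auto
  have eq: "sgn -` wedge p = {x. x $ 3 > 0} \<inter> (\<lambda>x. arctan (x $ 2 / x $ 3)) -` {- b<..<b}"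
    (is "_ = ?A")
  proof (intro equalityI subsetI)
    fix x assume "x \<in> sgn -` wedge p"
    then obtain \<phi> where "x $ 3 > 0" "\<phi> \<in> {- b<..<b}" "x $ 2 = x $ 3 * tan \<phi>"
      unfolding sgn_vimage_wedge by blast
    thus "x \<in> ?A" using arc by simp
  next
    fix x assume x: "x \<in> ?A"
    moreover have "x $ 2 = x $ 3 * tan (arctan (x $ 2 / x $ 3))" using x by (simp add: tan_arctan)
    ultimately show "x \<in> sgn -` wedge p" unfolding sgn_vimage_wedge by blast
  qed
  have "open {x :: real ^ 3. x $ 3 > 0}"
    by (intro open_Collect_less continuous_intros)
  moreover have "continuous_on {x :: real ^ 3. x $ 3 > 0} (\<lambda>x. arctan (x $ 2 / x $ 3))"
    by (intro continuous_intros) auto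
  ultimately show ?thesis
    unfolding eq by (intro continuous_open_preimage) auto
qed

lemma cone_eq: "{r *\<^sub>R x |r x. 0 < r \<and> r < 1 \<and> x \<in> wedge p} = ball 0 1 \<inter> sgn -` wedge p"
proof (intro equalityI subsetI)
  fix y assume "y \<in> {r *\<^sub>R x |r x. 0 < r \<and> r < 1 \<and> x \<in> wedge p}"
  then obtain r x where "y = r *\<^sub>R x" "0 < r" "r < 1" "x \<in> wedge p" by blast
  moreover from this have "norm x = 1" by (simp add: wedge_def)
  ultimately show "y \<in> ball 0 1 \<inter> sgn -` wedge p"
    by (simp add: sgn_scaleR sgn_div_norm)
next
  fix y :: "real ^ 3" assume y: "y \<in> ball 0 1 \<inter> sgn -` wedge p"
  hence "y \<noteq> 0" by (auto simp: wedge_def)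
  hence "y = norm y *\<^sub>R sgn y \<and> 0 < norm y \<and> norm y < 1 \<and> sgn y \<in> wedge p"
    using y by (simp add: sgn_div_norm)
  thus "y \<in> {r *\<^sub>R x |r x. 0 < r \<and> r < 1 \<and> x \<in> wedge p}" by blast
qed

text \<open>The points missed by the rotated open cones lie on their bounding half planes or on the
  axis. The \<open>k\<close>-th plane contains the lower edge of the \<open>k\<close>-th copy, and
  all planes contain the axis.\<close>

lemma ball_subset_rotated_cones:
  "ball 0 1 \<subseteq> (\<Union>k<2 * p. rot (2 * real k * b) ` (ball 0 1 \<inter> sgn -` wedge p))
     \<union> (\<Union>k<2 * p. {y :: real ^ 3. vector [0, cos (2 * real k * b - b), - sin (2 * real k * b - b)] \<bullet> y = 0})"
    (is "_ \<subseteq> _ \<union> ?N")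
proof
  fix y :: "real ^ 3" assume yb: "y \<in> ball 0 1"
  define \<rho> where "\<rho> = sqrt ((y $ 2)\<^sup>2 + (y $ 3)\<^sup>2)"
  have N: "y \<in> ?N \<longleftrightarrow> (\<exists>k<2 * p. cos (2 * real k * b - b) * y $ 2 = sin (2 * real k * b - b) * y $ 3)"
    by (simp add: inner_vec_def sum_3 vector_3 Bex_def)
  show "y \<in> (\<Union>k<2 * p. rot (2 * real k * b) ` (ball 0 1 \<inter> sgn -` wedge p)) \<union> ?N"
  proof (cases "\<rho> = 0")
    case True
    hence "y $ 2 = 0" "y $ 3 = 0" by (auto simp: \<rho>_def sum_power2_eq_zero_iff)
    hence "y \<in> ?N" using p unfolding N by (intro exI[of _ 0]) simp
    thus ?thesis by blast
  next
    case False
    hence \<rho>: "\<rho> > 0" by (simp add: \<rho>_def less_le)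
    have \<rho>2: "\<rho>\<^sup>2 = (y $ 2)\<^sup>2 + (y $ 3)\<^sup>2" by (simp add: \<rho>_def)
    \<comment> \<open>The angle is read off after a turn by \<open>b\<close>, so that
      \<open>t\<close> is measured from the lower edge of the copy \<open>k = 0\<close> and the
      number of the copy becomes a floor.\<close>
    have "((y $ 3 * cos b - y $ 2 * sin b) / \<rho>)\<^sup>2 + ((y $ 2 * cos b + y $ 3 * sin b) / \<rho>)\<^sup>2
       = ((y $ 3 * cos b - y $ 2 * sin b)\<^sup>2 + (y $ 2 * cos b + y $ 3 * sin b)\<^sup>2) / \<rho>\<^sup>2"
      by (simp only: power_divide add_divide_distrib[symmetric])
    also have "(y $ 3 * cos b - y $ 2 * sin b)\<^sup>2 + (y $ 2 * cos b + y $ 3 * sin b)\<^sup>2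
       = ((y $ 2)\<^sup>2 + (y $ 3)\<^sup>2) * ((sin b)\<^sup>2 + (cos b)\<^sup>2)"
      unfolding power2_eq_square by algebra
    also have "((y $ 2)\<^sup>2 + (y $ 3)\<^sup>2) * ((sin b)\<^sup>2 + (cos b)\<^sup>2) / \<rho>\<^sup>2 = 1"
      using \<rho> unfolding \<rho>2[symmetric] by simp
    finally obtain t where t: "0 \<le> t" "t < 2 * pi"
      "(y $ 3 * cos b - y $ 2 * sin b) / \<rho> = cos t" "(y $ 2 * cos b + y $ 3 * sin b) / \<rho> = sin t"
      by (rule sincos_total_2pi)
    hence t': "\<rho> * cos t = y $ 3 * cos b - y $ 2 * sin b"
      "\<rho> * sin t = y $ 2 * cos b + y $ 3 * sin b" using \<rho> by (auto simp: field_simps)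
    have sc: "cos b * cos b = 1 - sin b * sin b"
      using sin_cos_squared_add[of b] by (simp add: power2_eq_square)
    have y3: "y $ 3 = \<rho> * cos (t - b)"
    proof -
      have "\<rho> * cos (t - b) = (\<rho> * cos t) * cos b + (\<rho> * sin t) * sin b"
        by (simp add: cos_diff algebra_simps)
      also have "\<dots> = y $ 3 * (cos b * cos b) + y $ 3 * (sin b * sin b)"
        unfolding t' by (simp add: algebra_simps)
      finally show ?thesis unfolding sc by (simp add: algebra_simps)
    qed
    have y2: "y $ 2 = \<rho> * sin (t - b)"
    proof -
      have "\<rho> * sin (t - b) = (\<rho> * sin t) * cos b - (\<rho> * cos t) * sin b"
        by (simp add: sin_diff algebra_simps)
      also have "\<dots> = y $ 2 * (cos b * cos b) + y $ 2 * (sin b * sin b)"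
        unfolding t' by (simp add: algebra_simps)
      finally show ?thesis unfolding sc by (simp add: algebra_simps)
    qed
    define k where "k = nat \<lfloor>t / (2 * b)\<rfloor>"
    have "0 \<le> t / (2 * b)" using t half_angle by simp
    hence "real k \<le> t / (2 * b)" "t / (2 * b) < real k + 1"
      unfolding k_def by linarith+
    hence k: "2 * real k * b \<le> t" "t < 2 * real k * b + 2 * b"
      using half_angle by (simp_all add: field_simps)
    have kp: "k < 2 * p"
    proof (rule ccontr)
      assume "\<not> k < 2 * p"
      hence "2 * real (2 * p) * b \<le> 2 * real k * b" using half_angle by (intro mult_right_mono) auto
      moreover have "2 * real (2 * p) * b = 2 * pi" using p by (simp add: b_def)
      ultimately show False using k t by linarith
    qed
    define \<phi> where "\<phi> = t - b - 2 * real k * b"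
    have \<phi>: "- b \<le> \<phi>" "\<phi> < b" using k unfolding \<phi>_def by linarith+
    have tb: "t - b = \<phi> + 2 * real k * b" by (simp add: \<phi>_def)
    show ?thesis
    proof (cases "\<phi> = - b")
      case True
      hence "t - b = 2 * real k * b - b" unfolding tb by simp
      hence "y \<in> ?N" using kp unfolding N y2 y3 by (intro exI[of _ k]) simp
      thus ?thesis by blast
    next
      case False
      define v :: "real ^ 3" where "v = vector [y $ 1, \<rho> * sin \<phi>, \<rho> * cos \<phi>]"
      have v: "v $ 1 = y $ 1" "v $ 2 = \<rho> * sin \<phi>" "v $ 3 = \<rho> * cos \<phi>"
        by (simp_all add: v_def vector_3)
      have ry: "y = rot (2 * real k * b) v"
        unfolding vec_eq_iff forall_3 rot_nth v y2 y3 tb cos_add sin_add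
        by (simp add: algebra_simps)
      have "norm y = norm v"
        unfolding ry by (rule orthogonal_transformation_norm[OF orthogonal_transformation_rot])
      hence "v \<in> ball 0 1" using yb by simp
      moreover have "v \<in> sgn -` wedge p"
      proof -
        have "cos \<phi> > 0" using \<phi> False half_angle by (intro cos_gt_zero_pi) auto
        moreover have "\<phi> \<in> {- b<..<b}" using \<phi> False by auto
        ultimately show ?thesis unfolding sgn_vimage_wedge
          using \<rho> by (auto simp: v tan_def intro!: bexI[of _ \<phi>])
      qed
      ultimately show ?thesis using ry kp by blast
    qed
  qed
qed

text \<open>A covering suffices for this direction, by subadditivity and rotation invariance: 4/3 pi
  is at most \<open>2 * p\<close> times the volume of the cone. A lower bound on the area is an
  upper bound on the Weyl constant.\<close>

lemma sphere_volume_wedge_ge: "sphere_volume (wedge p) \<ge> 2 * pi / real p"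
proof -
  let ?K = "ball 0 1 \<inter> sgn -` wedge p"
  let ?R = "\<lambda>k. rot (2 * real k * b) ` ?K"
  let ?H = "\<lambda>k. {y :: real ^ 3. vector [0, cos (2 * real k * b - b), - sin (2 * real k * b - b)] \<bullet> y = 0}"
  let ?N = "\<Union>k<2 * p. ?H k"
  have K: "?K \<in> lmeasurable"
    by (intro lmeasurable_open bounded_Int open_Int open_sgn_vimage_wedge) auto
  have R: "?R k \<in> lmeasurable" "measure lebesgue (?R k) = measure lebesgue ?K" for k
    using measurable_orthogonal_image[OF orthogonal_transformation_rot K]
      measure_orthogonal_image[OF orthogonal_transformation_rot K] by blast+
  have "negligible (?H k)" for k
  proof (rule negligible_hyperplane)
    have "(vector [0, cos c, - sin c] :: real ^ 3) \<noteq> 0" for c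
    proof
      assume "(vector [0, cos c, - sin c] :: real ^ 3) = 0"
      hence "(vector [0, cos c, - sin c] :: real ^ 3) $ 2 = 0"
        "(vector [0, cos c, - sin c] :: real ^ 3) $ 3 = 0" by simp_all
      thus False using sin_cos_squared_add[of c] by (simp add: vector_3)
    qed
    thus "(vector [0, cos (2 * real k * b - b), - sin (2 * real k * b - b)] :: real ^ 3) \<noteq> 0 \<or> (0::real) \<noteq> 0"
      by blast
  qed
  hence N: "negligible ?N" by (intro negligible_Union) auto
  have U: "(\<Union>k<2 * p. ?R k) \<in> lmeasurable"
    by (rule fmeasurable.finite_UN) (use R(1) in blast)+
  have UN: "(\<Union>k<2 * p. ?R k) \<union> ?N \<in> lmeasurable"
    using U negligible_imp_measurable[OF N] by blast
  have "measure lebesgue (ball 0 1 :: (real ^ 3) set) \<le> measure lebesgue ((\<Union>k<2 * p. ?R k) \<union> ?N)"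
    by (rule measure_mono_fmeasurable[OF ball_subset_rotated_cones _ UN]) simp
  also have "\<dots> = measure lebesgue (\<Union>k<2 * p. ?R k)"
    by (rule measure_negligible_symdiff) (use U N in \<open>auto intro: negligible_subset\<close>)
  also have "\<dots> \<le> (\<Sum>k<2 * p. measure lebesgue (?R k))"
    by (rule measure_UNION_le) (use R(1) in auto)
  also have "\<dots> = real (2 * p) * measure lebesgue ?K" by (simp add: R(2))
  finally have "measure lebesgue (ball 0 1 :: (real ^ 3) set) \<le> real (2 * p) * measure lebesgue ?K" .
  moreover have "measure lebesgue (ball 0 1 :: (real ^ 3) set) = 4 / 3 * pi"
    using content_ball[of 1 "0 :: real ^ 3"] by (simp add: unit_ball_vol_3)
  ultimately show ?thesis
    using p unfolding sphere_volume_def cone_eq by (simp add: field_simps)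
qed

lemma weyl_constant_wedge_le: "weyl_constant (wedge p) \<le> 2 * real p"
proof -
  let ?v = "sphere_volume (wedge p)"
  have v: "?v \<ge> 2 * pi / real p" "2 * pi / real p > 0"
    using sphere_volume_wedge_ge p by auto
  hence "?v > 0" by linarith
  hence "weyl_constant (wedge p) = 4 * pi / ?v"
    by (simp add: weyl_constant_def Let_def unit_ball_vol_2 power2_eq_square)
  also have "\<dots> \<le> 4 * pi / (2 * pi / real p)"
    using v \<open>?v > 0\<close> by (intro divide_left_mono mult_pos_pos) auto
  also have "\<dots> = 2 * real p" using p by simp
  finally show ?thesis .
qed

end

subsection \<open>The Laplacian of radially constant functions\<close>

lemma C2_jet_inner_self:
  "C2_jet U (\<lambda>x. x \<bullet> x) (\<lambda>x. 2 *\<^sub>R blinfun_inner_left x)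
     (\<lambda>_. 2 *\<^sub>R Blinfun blinfun_inner_left)"
  unfolding C2_jet_def
  by (auto intro!: derivative_eq_intros bounded_linear_imp_has_derivative bounded_linear_intros
      simp: scaleR_blinfun.rep_eq bounded_linear_Blinfun_apply bounded_linear_blinfun_inner_left
        inner_commute algebra_simps
      intro: bounded_linear.has_derivative[OF bounded_linear_blinfun_inner_left])

lemma open_punctured: "open (- {0::'a::euclidean_space})"
  by auto

context
  fixes x :: "'a::euclidean_space"
  assumes x: "norm x = 1"
begin

lemma on_punctured: "x \<in> - {0}"
  using x by auto

lemma inner_self_1: "x \<bullet> x = 1"
  using x by (simp add: norm_eq_1)

end

lemma inv_norm_derivs:
  fixes s :: real
  assumes "s > 0"
  shows "((\<lambda>s. s powr - (1 / 2)) has_real_derivative - 1 / 2 * s powr (- 3 / 2)) (at s)"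
    and "((\<lambda>s. - 1 / 2 * s powr (- 3 / 2)) has_real_derivative 3 / 4 * s powr (- 5 / 2)) (at s)"
  using assms by (auto intro!: derivative_eq_intros)

lemma inv_norm_cont:
  "continuous_on ((\<lambda>x::'a::euclidean_space. x \<bullet> x) ` (- {0})) (\<lambda>s. 3 / 4 * s powr (- 5 / 2))"
  by (intro continuous_intros) auto

text \<open>With the inverse norm written as a power of the smooth function
  \<open>x \<bullet> x\<close>, all derivatives of \<open>sgn\<close> come from the product and
  chain rules. At \<open>x = 0\<close> both sides are 0.\<close>

lemma sgn_inner_eq: "sgn x \<bullet> a = (x \<bullet> x) powr - (1 / 2) * (x \<bullet> a)" for x :: "'a::euclidean_space"
proof (cases "x = 0")
  case False
  hence "(x \<bullet> x) powr - (1 / 2) = inverse (norm x)"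
    by (simp add: powr_minus norm_eq_sqrt_inner powr_half_sqrt)
  thus ?thesis by (simp add: sgn_div_norm)
qed simp

lemma C2_on_inner_self: "C2_on U (\<lambda>x. x \<bullet> x)"
  using C2_jet_inner_self unfolding C2_on_iff_jet by blast

lemma C2_on_inv_norm: "C2_on (- {0::'a::euclidean_space}) (\<lambda>x. (x \<bullet> x) powr - (1 / 2))"
  by (rule C2_on_compose[OF C2_on_inner_self inv_norm_derivs inv_norm_cont]) auto

lemma C2_on_sgn_inner: "C2_on (- {0::'a::euclidean_space}) (\<lambda>x. sgn x \<bullet> a)"
  unfolding sgn_inner_eq by (intro C2_on_mult C2_on_inv_norm C2_on_inner_left)

context
  fixes x :: "'a::euclidean_space"
  assumes x: "norm x = 1"
begin

lemma grad_inner_inner_self: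
  assumes "C2_jet (- {0}) f f' f''"
  shows "grad_inner f (\<lambda>x. x \<bullet> x) x = 2 * f' x x"
proof -
  have "grad_inner f (\<lambda>x. x \<bullet> x) x = (\<Sum>b\<in>Basis. f' x b * (2 * (x \<bullet> b)))"
    by (subst grad_inner_jet[OF assms C2_jet_inner_self on_punctured[OF x]])
       (simp add: scaleR_blinfun.rep_eq inner_commute)
  also have "\<dots> = 2 * f' x (\<Sum>b\<in>Basis. (x \<bullet> b) *\<^sub>R b)"
    by (simp add: blinfun.sum_right blinfun.scaleR_right sum_distrib_left mult_ac)
  finally show ?thesis by (simp add: euclidean_representation)
qed

lemma laplacian_inv_norm:
  "laplacian (\<lambda>x. (x \<bullet> x) powr - (1 / 2)) x = 3 - real DIM('a)"
proof -
  have "laplacian (\<lambda>x. x \<bullet> x) x = 2 * real DIM('a)"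
    by (subst laplacian_jet[OF open_punctured C2_jet_inner_self on_punctured[OF x]])
       (simp add: scaleR_blinfun.rep_eq bounded_linear_Blinfun_apply bounded_linear_blinfun_inner_left)
  moreover have "grad_inner (\<lambda>x. x \<bullet> x) (\<lambda>x. x \<bullet> x) x = 4"
    by (subst grad_inner_inner_self[OF C2_jet_inner_self])
       (simp add: scaleR_blinfun.rep_eq inner_self_1[OF x])
  ultimately show ?thesis
    by (subst laplacian_compose[OF open_punctured on_punctured[OF x] C2_on_inner_self inv_norm_derivs inv_norm_cont])
       (auto simp: inner_self_1[OF x])
qed

lemma grad_inner_inv_norm:
  assumes "C2_on (- {0}) h"
  shows "grad_inner h (\<lambda>x. (x \<bullet> x) powr - (1 / 2)) x = - 1 / 2 * grad_inner h (\<lambda>x. x \<bullet> x) x"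
  by (subst grad_inner_compose[OF open_punctured on_punctured[OF x] assms C2_on_inner_self inv_norm_derivs inv_norm_cont])
     (auto simp: inner_self_1[OF x])

lemma grad_inner_inv_norm_self:
  "grad_inner (\<lambda>x. (x \<bullet> x) powr - (1 / 2)) (\<lambda>x. (x \<bullet> x) powr - (1 / 2)) x = 1"
proof -
  have "grad_inner (\<lambda>x. x \<bullet> x) (\<lambda>x. x \<bullet> x) x = 4"
    by (subst grad_inner_inner_self[OF C2_jet_inner_self])
       (simp add: scaleR_blinfun.rep_eq inner_self_1[OF x])
  thus ?thesis
    by (subst grad_inner_inv_norm[OF C2_on_inv_norm], subst grad_inner_commute,
        subst grad_inner_inv_norm[OF C2_on_inner_self]) simp
qed

lemma grad_inner_linear_inv_norm:
  "grad_inner (\<lambda>x. x \<bullet> a) (\<lambda>x. (x \<bullet> x) powr - (1 / 2)) x = - (x \<bullet> a)"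
proof -
  have j: "C2_jet (- {0}) (\<lambda>x. x \<bullet> a) (\<lambda>_. blinfun_inner_left a) (\<lambda>_. 0)"
    using C2_jet_linear[of _ "blinfun_inner_left a"] by (simp add: blinfun_inner_left.rep_eq[abs_def])
  show ?thesis
    by (subst grad_inner_inv_norm[OF C2_on_inner_left], subst grad_inner_inner_self[OF j]) simp
qed

text \<open>Linear functions restrict to the spherical harmonics of degree 1. Together with the next
  formula this is the geometric input; the later Laplacians are reduced to the two by product and
  chain rules.\<close>

lemma laplacian_sgn_inner: "laplacian (\<lambda>x. sgn x \<bullet> a) x = (1 - real DIM('a)) * (x \<bullet> a)"
proof -
  have "laplacian (\<lambda>x. (x \<bullet> x) powr - (1 / 2) * (x \<bullet> a)) x = (x \<bullet> a) * (3 - real DIM('a)) - 2 * (x \<bullet> a)"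
    by (subst laplacian_mult[OF open_punctured on_punctured[OF x] C2_on_inv_norm C2_on_inner_left],
        subst laplacian_inner_left[OF open_punctured on_punctured[OF x]], subst laplacian_inv_norm,
        subst grad_inner_commute, subst grad_inner_linear_inv_norm) simp
  thus ?thesis unfolding sgn_inner_eq by (simp add: algebra_simps)
qed

text \<open>The gradients are the tangential projections of \<open>a\<close> and \<open>b\<close>,
  whence the correction by the normal components.\<close>

lemma grad_inner_sgn_inner:
  "grad_inner (\<lambda>x. sgn x \<bullet> a) (\<lambda>x. sgn x \<bullet> b) x = a \<bullet> b - (x \<bullet> a) * (x \<bullet> b)"
proof -
  note U = open_punctured on_punctured[OF x]
  let ?R = "\<lambda>x::'a. (x \<bullet> x) powr - (1 / 2)"
  have h: "C2_on (- {0}) (\<lambda>x. ?R x * (x \<bullet> a))" by (intro C2_on_mult C2_on_inv_norm C2_on_inner_left)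
  have R1: "?R x = 1" by (simp add: inner_self_1[OF x])
  have g: "grad_inner (\<lambda>x. x \<bullet> c) ?R x = - (x \<bullet> c)" "grad_inner ?R (\<lambda>x. x \<bullet> c) x = - (x \<bullet> c)" for c
    using grad_inner_linear_inv_norm[of c] by (simp_all add: grad_inner_commute)
  have 1: "grad_inner (\<lambda>x. x \<bullet> b) (\<lambda>x. ?R x * (x \<bullet> a)) x = a \<bullet> b - (x \<bullet> a) * (x \<bullet> b)"
    by (subst grad_inner_mult[OF U C2_on_inner_left C2_on_inv_norm C2_on_inner_left])
       (simp add: R1 g grad_inner_inner_left[OF U] inner_commute)
  have 2: "grad_inner ?R (\<lambda>x. ?R x * (x \<bullet> a)) x = 0"
    by (subst grad_inner_mult[OF U C2_on_inv_norm C2_on_inv_norm C2_on_inner_left])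
       (simp add: R1 g grad_inner_inv_norm_self)
  have "grad_inner (\<lambda>x. ?R x * (x \<bullet> a)) (\<lambda>x. ?R x * (x \<bullet> b)) x = a \<bullet> b - (x \<bullet> a) * (x \<bullet> b)"
    by (subst grad_inner_mult[OF U h C2_on_inv_norm C2_on_inner_left])
       (simp add: R1 1 2 grad_inner_commute[of "\<lambda>x. ?R x * (x \<bullet> a)"])
  thus ?thesis unfolding sgn_inner_eq .
qed

end

section \<open>Powers of the complex coordinate on the two-sphere\<close>

lemma C2_on_sgn_nth: "C2_on (- {0 :: real ^ 'n}) (\<lambda>x. sgn x $ i)"
  using C2_on_sgn_inner[of "axis i (1::real)"] by (simp add: inner_axis inner_real_def)

lemma laplacian_sgn_nth:
  "norm x = 1 \<Longrightarrow> laplacian (\<lambda>x. sgn x $ i) x = (1 - real CARD('n)) * x $ i" for x :: "real ^ 'n"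
  using laplacian_sgn_inner[of x "axis i (1::real)"] by (simp add: inner_axis inner_real_def)

lemma grad_inner_sgn_nth:
  "norm x = 1 \<Longrightarrow> grad_inner (\<lambda>x. sgn x $ i) (\<lambda>x. sgn x $ j) x = of_bool (i = j) - x $ i * x $ j"
  for x :: "real ^ 'n"
  using grad_inner_sgn_inner[of x "axis i (1::real)" "axis j 1"] by (simp add: inner_axis) (simp add: axis_def)

text \<open>The third coordinate is the real part, so that the argument is the angle \<phi> in the
  definition of the wedge.\<close>

definition zcoord :: "real ^ 3 \<Rightarrow> complex" where
  "zcoord x = Complex (x $ 3) (x $ 2)"

lemma sector_harmonic_Suc:
  "Re (zcoord x ^ Suc n) = x $ 3 * Re (zcoord x ^ n) - x $ 2 * Im (zcoord x ^ n)"
  "Im (zcoord x ^ Suc n) = x $ 3 * Im (zcoord x ^ n) + x $ 2 * Re (zcoord x ^ n)"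
  by (simp_all add: zcoord_def)

lemma C2_on_zcoord_power:
  "C2_on (- {0}) (\<lambda>x. Re (zcoord (sgn x) ^ n))" "C2_on (- {0}) (\<lambda>x. Im (zcoord (sgn x) ^ n))"
proof (induction n)
  case (Suc n)
  { case 1 show ?case unfolding sector_harmonic_Suc by (intro C2_on_diff C2_on_mult C2_on_sgn_nth Suc.IH) }
  { case 2 show ?case unfolding sector_harmonic_Suc by (intro C2_on_add C2_on_mult C2_on_sgn_nth Suc.IH) }
qed auto

context
  fixes x :: "real ^ 3"
  assumes x: "norm x = 1"
begin

lemma sgn_fix: "sgn x = x" using x by (simp add: sgn_div_norm)

lemmas pt = open_punctured on_punctured[OF x]

text \<open>For \<open>n = 0\<close> the truncated exponent \<open>n - 1\<close> is harmless, because of the factor \<open>n\<close>.\<close>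

lemma grad_inner_coords_zcoord_power:
  "grad_inner (\<lambda>x. sgn x $ 1) (\<lambda>x. Re (zcoord (sgn x) ^ n)) x = - real n * x $ 1 * Re (zcoord x ^ n)"
  "grad_inner (\<lambda>x. sgn x $ 1) (\<lambda>x. Im (zcoord (sgn x) ^ n)) x = - real n * x $ 1 * Im (zcoord x ^ n)"
  "grad_inner (\<lambda>x. sgn x $ 2) (\<lambda>x. Re (zcoord (sgn x) ^ n)) x
     = real n * (- Im (zcoord x ^ (n - 1)) - x $ 2 * Re (zcoord x ^ n))"
  "grad_inner (\<lambda>x. sgn x $ 2) (\<lambda>x. Im (zcoord (sgn x) ^ n)) x
     = real n * (Re (zcoord x ^ (n - 1)) - x $ 2 * Im (zcoord x ^ n))"
  "grad_inner (\<lambda>x. sgn x $ 3) (\<lambda>x. Re (zcoord (sgn x) ^ n)) x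
     = real n * (Re (zcoord x ^ (n - 1)) - x $ 3 * Re (zcoord x ^ n))"
  "grad_inner (\<lambda>x. sgn x $ 3) (\<lambda>x. Im (zcoord (sgn x) ^ n)) x
     = real n * (Im (zcoord x ^ (n - 1)) - x $ 3 * Im (zcoord x ^ n))"
proof (induction n)
  case 0
  { case 1 show ?case by (simp add: grad_inner_const[OF pt]) }
  { case 2 show ?case by (simp add: grad_inner_const[OF pt]) }
  { case 3 show ?case by (simp add: grad_inner_const[OF pt]) }
  { case 4 show ?case by (simp add: grad_inner_const[OF pt]) }
  { case 5 show ?case by (simp add: grad_inner_const[OF pt]) }
  { case 6 show ?case by (simp add: grad_inner_const[OF pt]) }
next
  case (Suc n)
  define A B where "A = Re (zcoord x ^ n)" and "B = Im (zcoord x ^ n)"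
  define A' B' where "A' = real n * Re (zcoord x ^ (n - 1))" and "B' = real n * Im (zcoord x ^ (n - 1))"
  \<comment> \<open>This is n z^n = z (n z^(n-1)), true for \<open>n = 0\<close> as well; it
    eliminates the lower power from the recursion.\<close>
  have AB: "real n * A = x $ 3 * A' - x $ 2 * B'" "real n * B = x $ 3 * B' + x $ 2 * A'"
    unfolding A_def B_def A'_def B'_def
    by (cases n; simp add: zcoord_def algebra_simps)+
  note IH = Suc.IH[unfolded right_diff_distrib mult_minus_right, folded A_def B_def A'_def B'_def]
  have recRe: "grad_inner (\<lambda>x. sgn x $ i) (\<lambda>x. Re (zcoord (sgn x) ^ Suc n)) x =
      x $ 3 * grad_inner (\<lambda>x. sgn x $ i) (\<lambda>x. Re (zcoord (sgn x) ^ n)) x + A * (of_bool (i = 3) - x $ i * x $ 3)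
      - (x $ 2 * grad_inner (\<lambda>x. sgn x $ i) (\<lambda>x. Im (zcoord (sgn x) ^ n)) x + B * (of_bool (i = 2) - x $ i * x $ 2))" for i
    unfolding sector_harmonic_Suc
    by (subst grad_inner_diff[OF pt], intro C2_on_sgn_nth, intro C2_on_mult C2_on_sgn_nth C2_on_zcoord_power,
        intro C2_on_mult C2_on_sgn_nth C2_on_zcoord_power,
        subst grad_inner_mult[OF pt C2_on_sgn_nth C2_on_sgn_nth C2_on_zcoord_power(1)],
        subst grad_inner_mult[OF pt C2_on_sgn_nth C2_on_sgn_nth C2_on_zcoord_power(2)])
       (simp add: grad_inner_sgn_nth[OF x] sgn_fix A_def B_def)
  have recIm: "grad_inner (\<lambda>x. sgn x $ i) (\<lambda>x. Im (zcoord (sgn x) ^ Suc n)) x =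
      x $ 3 * grad_inner (\<lambda>x. sgn x $ i) (\<lambda>x. Im (zcoord (sgn x) ^ n)) x + B * (of_bool (i = 3) - x $ i * x $ 3)
      + (x $ 2 * grad_inner (\<lambda>x. sgn x $ i) (\<lambda>x. Re (zcoord (sgn x) ^ n)) x + A * (of_bool (i = 2) - x $ i * x $ 2))" for i
    unfolding sector_harmonic_Suc
    by (subst grad_inner_add[OF pt], intro C2_on_sgn_nth, intro C2_on_mult C2_on_sgn_nth C2_on_zcoord_power,
        intro C2_on_mult C2_on_sgn_nth C2_on_zcoord_power,
        subst grad_inner_mult[OF pt C2_on_sgn_nth C2_on_sgn_nth C2_on_zcoord_power(1)],
        subst grad_inner_mult[OF pt C2_on_sgn_nth C2_on_sgn_nth C2_on_zcoord_power(2)])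
       (simp add: grad_inner_sgn_nth[OF x] sgn_fix A_def B_def)
  have S: "Re (zcoord x ^ Suc n) = x $ 3 * A - x $ 2 * B" "Im (zcoord x ^ Suc n) = x $ 3 * B + x $ 2 * A"
    unfolding sector_harmonic_Suc A_def B_def by simp_all
  have Sn: "Suc n - 1 = n" by simp
  { case 1 show ?case unfolding recRe recIm IH S by (simp add: algebra_simps) }
  { case 2 show ?case unfolding recRe recIm IH S by (simp add: algebra_simps) }
  { case 3 show ?case unfolding recRe recIm IH S Sn A_def[symmetric] B_def[symmetric] using AB by simp algebra }
  { case 4 show ?case unfolding recRe recIm IH S Sn A_def[symmetric] B_def[symmetric] using AB by simp algebra }
  { case 5 show ?case unfolding recRe recIm IH S Sn A_def[symmetric] B_def[symmetric] using AB by simp algebra }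
  { case 6 show ?case unfolding recRe recIm IH S Sn A_def[symmetric] B_def[symmetric] using AB by simp algebra }
qed

text \<open>The powers of \<open>zcoord\<close> are harmonic and homogeneous of degree
  \<open>n\<close>, which explains the eigenvalue n (n + 1). The induction goes through the product
  rule for the radially constant extensions.\<close>

lemma laplacian_zcoord_power:
  "laplacian (\<lambda>x. Re (zcoord (sgn x) ^ n)) x = - real n * (real n + 1) * Re (zcoord x ^ n)"
  "laplacian (\<lambda>x. Im (zcoord (sgn x) ^ n)) x = - real n * (real n + 1) * Im (zcoord x ^ n)"
proof (induction n)
  case 0
  { case 1 show ?case by (simp add: laplacian_const[OF pt]) }
  { case 2 show ?case by (simp add: laplacian_const[OF pt]) }
next
  case (Suc n)
  define A B where "A = Re (zcoord x ^ n)" and "B = Im (zcoord x ^ n)"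
  define A' B' where "A' = real n * Re (zcoord x ^ (n - 1))" and "B' = real n * Im (zcoord x ^ (n - 1))"
  note IH = Suc.IH[folded A_def B_def]
  note G = grad_inner_coords_zcoord_power[of n, unfolded right_diff_distrib mult_minus_right,
      folded A_def B_def A'_def B'_def]
  have recRe: "laplacian (\<lambda>x. Re (zcoord (sgn x) ^ Suc n)) x =
      x $ 3 * laplacian (\<lambda>x. Re (zcoord (sgn x) ^ n)) x - 2 * (A * x $ 3)
        + 2 * grad_inner (\<lambda>x. sgn x $ 3) (\<lambda>x. Re (zcoord (sgn x) ^ n)) x
      - (x $ 2 * laplacian (\<lambda>x. Im (zcoord (sgn x) ^ n)) x - 2 * (B * x $ 2)
        + 2 * grad_inner (\<lambda>x. sgn x $ 2) (\<lambda>x. Im (zcoord (sgn x) ^ n)) x)"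
    unfolding sector_harmonic_Suc
    by (subst laplacian_diff[OF pt], intro C2_on_mult C2_on_sgn_nth C2_on_zcoord_power,
        intro C2_on_mult C2_on_sgn_nth C2_on_zcoord_power,
        subst laplacian_mult[OF pt C2_on_sgn_nth C2_on_zcoord_power(1)],
        subst laplacian_mult[OF pt C2_on_sgn_nth C2_on_zcoord_power(2)])
       (simp add: laplacian_sgn_nth[OF x] sgn_fix A_def B_def)
  have recIm: "laplacian (\<lambda>x. Im (zcoord (sgn x) ^ Suc n)) x =
      x $ 3 * laplacian (\<lambda>x. Im (zcoord (sgn x) ^ n)) x - 2 * (B * x $ 3)
        + 2 * grad_inner (\<lambda>x. sgn x $ 3) (\<lambda>x. Im (zcoord (sgn x) ^ n)) x
      + (x $ 2 * laplacian (\<lambda>x. Re (zcoord (sgn x) ^ n)) x - 2 * (A * x $ 2)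
        + 2 * grad_inner (\<lambda>x. sgn x $ 2) (\<lambda>x. Re (zcoord (sgn x) ^ n)) x)"
    unfolding sector_harmonic_Suc
    by (subst laplacian_add[OF pt], intro C2_on_mult C2_on_sgn_nth C2_on_zcoord_power,
        intro C2_on_mult C2_on_sgn_nth C2_on_zcoord_power,
        subst laplacian_mult[OF pt C2_on_sgn_nth C2_on_zcoord_power(1)],
        subst laplacian_mult[OF pt C2_on_sgn_nth C2_on_zcoord_power(2)])
       (simp add: laplacian_sgn_nth[OF x] sgn_fix A_def B_def)
  have S: "Re (zcoord x ^ Suc n) = x $ 3 * A - x $ 2 * B" "Im (zcoord x ^ Suc n) = x $ 3 * B + x $ 2 * A"
    unfolding sector_harmonic_Suc A_def B_def by simp_all
  { case 1 show ?case unfolding recRe IH G S of_nat_Suc by (simp add: algebra_simps) }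
  { case 2 show ?case unfolding recIm IH G S of_nat_Suc by (simp add: algebra_simps) }
qed

text \<open>The cross term of the product rule contributes -2 n x_1 G' S. It changes the Legendre
  coefficient 2 x_1 into the 2 (n + 1) x_1 of \<open>gegenbauer_ode\<close>, and the constants add
  up: n (n + 1) + j (j + 2 n + 1) = (n + j) (n + j + 1).\<close>

lemma laplacian_eigenfunction:
  fixes a c :: real and n j :: nat
  defines "S \<equiv> \<lambda>x. a * Re (zcoord x ^ n) + c * Im (zcoord x ^ n)"
  shows "laplacian (\<lambda>x. poly (gegenbauer n j) (sgn x $ 1) * S (sgn x)) x
    = - real ((n + j) * (n + j + 1)) * (poly (gegenbauer n j) (x $ 1) * S x)"
proof -
  let ?G = "gegenbauer n j"
  have CS: "C2_on (- {0}) (\<lambda>x. S (sgn x))"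
    unfolding S_def by (intro C2_on_add C2_on_cmult C2_on_zcoord_power)
  have CG: "C2_on (- {0 :: real ^ 3}) (\<lambda>x. poly ?G (sgn x $ 1))"
    by (rule C2_on_compose[OF C2_on_sgn_nth poly_DERIV poly_DERIV]) (intro continuous_intros)
  have lS: "laplacian (\<lambda>x. S (sgn x)) x = - real n * (real n + 1) * S x"
    unfolding S_def
    by (subst laplacian_add[OF pt C2_on_cmult[OF C2_on_zcoord_power(1)] C2_on_cmult[OF C2_on_zcoord_power(2)]],
        subst laplacian_cmult[OF pt C2_on_zcoord_power(1)], subst laplacian_cmult[OF pt C2_on_zcoord_power(2)])
       (simp add: laplacian_zcoord_power algebra_simps)
  have gS: "grad_inner (\<lambda>x. sgn x $ 1) (\<lambda>x. S (sgn x)) x = - real n * x $ 1 * S x"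
    unfolding S_def
    by (subst grad_inner_add[OF pt C2_on_sgn_nth C2_on_cmult[OF C2_on_zcoord_power(1)] C2_on_cmult[OF C2_on_zcoord_power(2)]],
        subst grad_inner_cmult[OF pt C2_on_sgn_nth C2_on_zcoord_power(1)],
        subst grad_inner_cmult[OF pt C2_on_sgn_nth C2_on_zcoord_power(2)])
       (simp add: grad_inner_coords_zcoord_power algebra_simps)
  have lG: "laplacian (\<lambda>x. poly ?G (sgn x $ 1)) x
      = poly (pderiv ?G) (x $ 1) * (- 2 * x $ 1) + poly (pderiv (pderiv ?G)) (x $ 1) * (1 - x $ 1 * x $ 1)"
    by (subst laplacian_compose[OF pt C2_on_sgn_nth poly_DERIV poly_DERIV])
       (auto intro!: continuous_intros simp: laplacian_sgn_nth[OF x] grad_inner_sgn_nth[OF x] sgn_fix)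
  have gG: "grad_inner (\<lambda>x. poly ?G (sgn x $ 1)) (\<lambda>x. S (sgn x)) x
      = poly (pderiv ?G) (x $ 1) * (- real n * x $ 1 * S x)"
    by (subst grad_inner_commute, subst grad_inner_compose[OF pt CS C2_on_sgn_nth poly_DERIV poly_DERIV])
       (auto intro!: continuous_intros simp: gS sgn_fix grad_inner_commute[of "\<lambda>x. S (sgn x)"])
  have ode: "(1 - x $ 1 * x $ 1) * poly (pderiv (pderiv ?G)) (x $ 1) =
      2 * (real n + 1) * x $ 1 * poly (pderiv ?G) (x $ 1)
        - real j * (real j + 2 * real n + 1) * poly ?G (x $ 1)"
    using arg_cong[OF gegenbauer_ode[of n j], of "\<lambda>q. poly q (x $ 1)"] by (simp add: algebra_simps)
  have "laplacian (\<lambda>x. poly ?G (sgn x $ 1) * S (sgn x)) x =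
      poly ?G (x $ 1) * (- real n * (real n + 1) * S x) +
      S x * (poly (pderiv ?G) (x $ 1) * (- 2 * x $ 1) + poly (pderiv (pderiv ?G)) (x $ 1) * (1 - x $ 1 * x $ 1))
      + 2 * (poly (pderiv ?G) (x $ 1) * (- real n * x $ 1 * S x))"
    by (subst laplacian_mult[OF pt CG CS]) (simp only: lS lG gG sgn_fix)
  also have "\<dots> = - ((real n + real j) * (real n + real j + 1)) * (poly ?G (x $ 1) * S x)"
    using ode by algebra
  finally show ?thesis by (simp only: of_nat_mult of_nat_add of_nat_1 minus_mult_left)
qed

end

lemma C2_on_eigenfunction:
  "C2_on (- {0}) (\<lambda>x. poly q (sgn x $ 1) * (a * Re (zcoord (sgn x) ^ n) + c * Im (zcoord (sgn x) ^ n)))"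
  by (intro C2_on_mult C2_on_add C2_on_cmult C2_on_zcoord_power
      C2_on_compose[OF C2_on_sgn_nth poly_DERIV poly_DERIV] continuous_intros)

subsection \<open>Parametrization of the wedge and the inner product\<close>

text \<open>Cylindrical coordinates about the first axis. They extend continuously to the closed
  rectangle, whose sides at first coordinate -1 and 1 collapse to the poles.\<close>

definition wedge_param :: "real \<times> real \<Rightarrow> real ^ 3" where
  "wedge_param z = fst z *\<^sub>R axis 1 1
     + (sqrt (1 - (fst z)\<^sup>2) * sin (snd z)) *\<^sub>R axis 2 1
     + (sqrt (1 - (fst z)\<^sup>2) * cos (snd z)) *\<^sub>R axis 3 1"

lemma wedge_param_nth [simp]:
  "wedge_param z $ 1 = fst z"
  "wedge_param z $ 2 = sqrt (1 - (fst z)\<^sup>2) * sin (snd z)"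
  "wedge_param z $ 3 = sqrt (1 - (fst z)\<^sup>2) * cos (snd z)"
  by (simp_all add: wedge_param_def axis_def)

lemma continuous_on_wedge_param: "continuous_on A wedge_param"
  unfolding wedge_param_def by (intro continuous_intros)

lemma zcoord_wedge_param: "zcoord (wedge_param z) = of_real (sqrt (1 - (fst z)\<^sup>2)) * cis (snd z)"
  by (simp add: zcoord_def complex_eq_iff)

text \<open>The substitution carries the interval to [0, pi], and the antiderivative, a multiple of
  the sine of \<open>k\<close> times the new angle, vanishes at both ends. Here \<open>k\<close> is
  real so that it can be a sum or a difference of frequencies.\<close>

lemma integral_cos_affine_eq_0:
  fixes k p :: real
  assumes "p > 0" "k \<noteq> 0" "sin (k * pi) = 0"
  shows "((\<lambda>\<phi>. cos (k * (p * \<phi> + pi / 2))) has_integral 0) {- (pi / (2 * p))..pi / (2 * p)}"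
proof -
  let ?F = "\<lambda>\<phi>. sin (k * (p * \<phi> + pi / 2)) / (k * p)"
  have "((\<lambda>\<phi>. cos (k * (p * \<phi> + pi / 2))) has_integral ?F (pi / (2 * p)) - ?F (- (pi / (2 * p))))
    {- (pi / (2 * p))..pi / (2 * p)}"
  proof (rule fundamental_theorem_of_calculus)
    show "- (pi / (2 * p)) \<le> pi / (2 * p)" using assms by simp
    fix \<phi>
    have "(?F has_real_derivative cos (k * (p * \<phi> + pi / 2))) (at \<phi>)"
      using assms by (auto intro!: derivative_eq_intros)
    thus "(?F has_vector_derivative cos (k * (p * \<phi> + pi / 2))) (at \<phi> within {- (pi / (2 * p))..pi / (2 * p)})"
      unfolding has_real_derivative_iff_has_vector_derivative[symmetric]
      by (rule has_field_derivative_at_within)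
  qed
  moreover have "p * (pi / (2 * p)) + pi / 2 = pi" "p * (- (pi / (2 * p))) + pi / 2 = 0"
    using assms by (simp_all add: field_simps)
  hence "?F (pi / (2 * p)) - ?F (- (pi / (2 * p))) = 0"
    using assms(3) by (simp only:) simp
  ultimately show ?thesis by (simp only:)
qed

lemma mem_box_Pair: "(x, y) \<in> box (a, c) (b, d) \<longleftrightarrow> x \<in> box a b \<and> y \<in> box c d"
  by (auto simp: mem_box Basis_prod_def ball_Un)

section \<open>The wedge in cylindrical coordinates\<close>

context wedge_geometry
begin

lemma wedge_eq_param: "wedge p = wedge_param ` box (-1, - b) (1, b)"
proof (intro equalityI subsetI)
  fix x assume x: "x \<in> wedge p"
  hence nx: "norm x = 1" by (simp add: wedge_def)
  hence "sgn x = x" by (simp add: sgn_div_norm)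
  hence "x \<in> sgn -` wedge p" using x by simp
  then obtain \<phi> where \<phi>: "x $ 3 > 0" "\<phi> \<in> {- b<..<b}" "x $ 2 = x $ 3 * tan \<phi>"
    unfolding sgn_vimage_wedge by blast
  have cp: "cos \<phi> > 0" using \<phi> half_angle by (intro cos_gt_zero_pi) auto
  have "x \<bullet> x = 1" using nx by (simp add: norm_eq_1)
  hence n1: "(x $ 1)\<^sup>2 + (x $ 2)\<^sup>2 + (x $ 3)\<^sup>2 = 1" by (simp add: inner_vec_def sum_3 power2_eq_square)
  have "x $ 2 = x $ 3 / cos \<phi> * sin \<phi>" "x $ 3 = x $ 3 / cos \<phi> * cos \<phi>"
    using cp by (simp_all add: \<phi>(3) tan_def)
  hence "(x $ 2)\<^sup>2 + (x $ 3)\<^sup>2 = (x $ 3 / cos \<phi>)\<^sup>2 * ((sin \<phi>)\<^sup>2 + (cos \<phi>)\<^sup>2)"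
    by (metis distrib_left power_mult_distrib)
  hence "1 - (x $ 1)\<^sup>2 = (x $ 3 / cos \<phi>)\<^sup>2" using n1 by simp
  hence s: "sqrt (1 - (x $ 1)\<^sup>2) = x $ 3 / cos \<phi>" using \<phi> cp by simp
  have "x = wedge_param (x $ 1, \<phi>)"
    using cp unfolding vec_eq_iff forall_3 wedge_param_nth fst_conv snd_conv s
    by (simp add: \<phi>(3) tan_def)
  moreover have "(x $ 1)\<^sup>2 < 1" using n1 \<phi>(1) zero_less_power[of "x $ 3" 2] zero_le_power2[of "x $ 2"] by linarith
  hence "\<bar>x $ 1\<bar> < 1" by (simp add: abs_square_less_1)
  hence "(x $ 1, \<phi>) \<in> box (-1, - b) (1, b)" using \<phi> by (simp add: mem_box_Pair abs_less_iff)
  ultimately show "x \<in> wedge_param ` box (-1, - b) (1, b)" by blast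
next
  fix x assume "x \<in> wedge_param ` box (-1, - b) (1, b)"
  then obtain t \<phi> where x: "x = wedge_param (t, \<phi>)" and t: "\<bar>t\<bar> < 1" "\<phi> \<in> {- b<..<b}"
    by (auto simp: mem_box_Pair)
  have cp: "cos \<phi> > 0" using t half_angle by (intro cos_gt_zero_pi) auto
  have t2: "t\<^sup>2 < 1" using t by (simp add: abs_square_less_1)
  have "x \<bullet> x = t\<^sup>2 + (sqrt (1 - t\<^sup>2))\<^sup>2 * ((sin \<phi>)\<^sup>2 + (cos \<phi>)\<^sup>2)"
    unfolding x inner_vec_def sum_3 wedge_param_nth fst_conv snd_conv inner_real_def power2_eq_square
    by algebra
  hence "x \<bullet> x = 1" using t2 by simp
  hence "norm x = 1" by (simp add: norm_eq_1)
  moreover have "x \<in> sgn -` wedge p"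
    unfolding sgn_vimage_wedge using t t2 cp
    by (auto simp: x tan_def intro!: bexI[of _ \<phi>])
  ultimately show "x \<in> wedge p" by (simp add: sgn_div_norm)
qed

text \<open>The image of the closed rectangle is compact, hence closed; conversely, continuity sends
  the closure of the open box into the closure of its image.\<close>

lemma closure_wedge_eq_param: "closure (wedge p) = wedge_param ` cbox (-1, - b) (1, b)"
proof (intro equalityI)
  have "compact (wedge_param ` cbox (-1, - b) (1, b))"
    by (intro compact_continuous_image continuous_on_wedge_param compact_cbox)
  thus "closure (wedge p) \<subseteq> wedge_param ` cbox (-1, - b) (1, b)"
    unfolding wedge_eq_param
    by (intro closure_minimal compact_imp_closed image_mono box_subset_cbox)
  have "(0 :: real, 0) \<in> box (-1, - b) (1, b)" using half_angle by (simp add: mem_box_Pair)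
  hence "closure (box (-1 :: real, - b) (1, b)) = cbox (-1, - b) (1, b)"
    by (intro closure_box) blast
  moreover have "wedge_param ` closure (box (-1, - b) (1, b)) \<subseteq> closure (wedge p)"
    by (rule image_closure_subset[OF continuous_on_wedge_param closed_closure])
       (simp add: wedge_eq_param closure_subset)
  ultimately show "wedge_param ` cbox (-1, - b) (1, b) \<subseteq> closure (wedge p)" by simp
qed

lemma compact_closure_wedge: "compact (closure (wedge p))"
  unfolding closure_wedge_eq_param
  by (intro compact_continuous_image continuous_on_wedge_param compact_cbox)

lemma wedge_subset_sphere: "wedge p \<subseteq> sphere 0 1"
  by (auto simp: wedge_def)

text \<open>Multiplied by \<i>, the \<open>p\<close>-th power opens the wedge to the upper half
  plane, so imaginary parts of its powers vanish on both edges.\<close>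

definition sector :: "nat \<Rightarrow> real ^ 3 \<Rightarrow> real" where
  "sector m x = Im ((\<i> * zcoord x ^ p) ^ m)"

lemma sector_eq:
  "sector m x = Im (\<i> ^ m) * Re (zcoord x ^ (p * m)) + Re (\<i> ^ m) * Im (zcoord x ^ (p * m))"
  by (simp add: sector_def power_mult_distrib power_mult)

lemma sector_param:
  "sector m (wedge_param (t, \<phi>)) = sqrt (1 - t\<^sup>2) ^ (p * m) * sin (real m * (real p * \<phi> + pi / 2))"
proof -
  have "\<i> * zcoord (wedge_param (t, \<phi>)) ^ p
      = of_real (sqrt (1 - t\<^sup>2) ^ p) * (cis (pi / 2) * cis (real p * \<phi>))"
    by (simp add: zcoord_wedge_param power_mult_distrib Complex.DeMoivre)
  also have "\<dots> = of_real (sqrt (1 - t\<^sup>2) ^ p) * cis (real p * \<phi> + pi / 2)"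
    by (simp only: cis_mult add.commute)
  finally have "(\<i> * zcoord (wedge_param (t, \<phi>)) ^ p) ^ m
      = of_real (sqrt (1 - t\<^sup>2) ^ (p * m)) * cis (real m * (real p * \<phi> + pi / 2))"
    by (simp only: power_mult_distrib Complex.DeMoivre of_real_power[symmetric] power_mult)
  thus ?thesis unfolding sector_def by simp
qed

lemma angle_range:
  "\<phi> \<in> {- b..b} \<Longrightarrow> 0 \<le> real p * \<phi> + pi / 2 \<and> real p * \<phi> + pi / 2 \<le> pi"
  "\<phi> \<in> {- b<..<b} \<Longrightarrow> 0 < real p * \<phi> + pi / 2 \<and> real p * \<phi> + pi / 2 < pi"
proof -
  have pb: "real p * b = pi / 2" using p by (simp add: b_def)
  show "0 \<le> real p * \<phi> + pi / 2 \<and> real p * \<phi> + pi / 2 \<le> pi" if "\<phi> \<in> {- b..b}"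
    using mult_left_mono[of "- b" \<phi> "real p"] mult_left_mono[of \<phi> b "real p"] pb that by auto
  show "0 < real p * \<phi> + pi / 2 \<and> real p * \<phi> + pi / 2 < pi" if "\<phi> \<in> {- b<..<b}"
    using mult_strict_left_mono[of "- b" \<phi> "real p"] mult_strict_left_mono[of \<phi> b "real p"] pb that p
    by auto
qed

lemma sector_boundary:
  assumes "x \<in> closure (wedge p)" "x \<notin> wedge p" "m \<ge> 1"
  shows "sector m x = 0"
proof -
  obtain t \<phi> where x: "x = wedge_param (t, \<phi>)" and t: "-1 \<le> t" "t \<le> 1" "- b \<le> \<phi>" "\<phi> \<le> b"
    using assms(1) unfolding closure_wedge_eq_param by auto
  have "(t, \<phi>) \<notin> box (-1, - b) (1, b)" using assms(2) x unfolding wedge_eq_param by blast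
  hence "t = -1 \<or> t = 1 \<or> \<phi> = - b \<or> \<phi> = b" using t by (auto simp: mem_box_Pair)
  moreover have "real p * b = pi / 2" using p by (simp add: b_def)
  ultimately have "t\<^sup>2 = 1 \<or> real p * \<phi> + pi / 2 = 0 \<or> real p * \<phi> + pi / 2 = pi" by auto
  thus ?thesis
    unfolding x sector_param using p assms(3) by (auto simp: power_0_left)
qed

lemma sector_1_pos: "x \<in> wedge p \<Longrightarrow> sector 1 x > 0"
proof -
  assume "x \<in> wedge p"
  then obtain t \<phi> where x: "x = wedge_param (t, \<phi>)" and t: "\<bar>t\<bar> < 1" "\<phi> \<in> {- b<..<b}"
    unfolding wedge_eq_param by (auto simp: mem_box_Pair)
  have "t\<^sup>2 < 1" using t by (simp add: abs_square_less_1)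
  moreover have "sin (real p * \<phi> + pi / 2) > 0"
    using angle_range(2)[OF t(2)] by (intro sin_gt_zero) auto
  ultimately show ?thesis unfolding x sector_param by simp
qed

lemma continuous_on_sector: "continuous_on A (sector m)"
  unfolding sector_def zcoord_def Complex_eq by (intro continuous_intros)

text \<open>Cut off outside the wedge as \<open>dirichlet_eigenspace\<close> demands. For
  \<open>m \<ge> 1\<close> the cut creates no jump, because the sector factor vanishes on the
  boundary.\<close>

definition wedge_fun :: "real poly \<Rightarrow> nat \<Rightarrow> real ^ 3 \<Rightarrow> real" where
  "wedge_fun q m x = (if x \<in> wedge p then poly q (x $ 1) * sector m x else 0)"

lemma wedge_fun_closure:
  "m \<ge> 1 \<Longrightarrow> x \<in> closure (wedge p) \<Longrightarrow> wedge_fun q m x = poly q (x $ 1) * sector m x"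
  using sector_boundary by (auto simp: wedge_fun_def)

definition wedge_C0 :: "(real ^ 3 \<Rightarrow> real) \<Rightarrow> bool" where
  "wedge_C0 f \<longleftrightarrow> continuous_on (closure (wedge p)) f \<and> (\<forall>x. x \<notin> wedge p \<longrightarrow> f x = 0)"

lemma wedge_C0_wedge_fun: "m \<ge> 1 \<Longrightarrow> wedge_C0 (wedge_fun q m)"
proof -
  assume m: "m \<ge> 1"
  have "continuous_on (closure (wedge p)) (\<lambda>x. poly q (x $ 1) * sector m x)"
    by (intro continuous_intros continuous_on_sector)
  hence "continuous_on (closure (wedge p)) (wedge_fun q m)"
    by (rule continuous_on_eq) (simp add: wedge_fun_closure[OF m])
  thus ?thesis by (simp add: wedge_C0_def wedge_fun_def)
qed

lemma wedge_C0_lincomb: "wedge_C0 f \<Longrightarrow> wedge_C0 g \<Longrightarrow> wedge_C0 (\<lambda>x. c * f x + g x)"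
  by (auto simp: wedge_C0_def intro!: continuous_intros)

text \<open>
  The parametrization by \<open>(x\<^sub>1, \<phi>)\<close> preserves area (Archimedes), so this is the inner product of \<open>L\<^sup>2\<close>.
\<close>

definition wedge_inner :: "(real ^ 3 \<Rightarrow> real) \<Rightarrow> (real ^ 3 \<Rightarrow> real) \<Rightarrow> real" where
  "wedge_inner f g = integral (cbox (-1, - b) (1, b)) (\<lambda>z. f (wedge_param z) * g (wedge_param z))"

lemma continuous_on_param:
  "continuous_on (closure (wedge p)) f \<Longrightarrow> continuous_on (cbox (-1, - b) (1, b)) (\<lambda>z. f (wedge_param z))"
  by (rule continuous_on_compose2[OF _ continuous_on_wedge_param])
     (auto simp: closure_wedge_eq_param)

lemma wedge_inner_integrable:
  assumes "wedge_C0 f" "wedge_C0 g"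
  shows "(\<lambda>z. f (wedge_param z) * g (wedge_param z)) integrable_on cbox (-1, - b) (1, b)"
  using assms by (intro integrable_continuous continuous_intros continuous_on_param) (auto simp: wedge_C0_def)

lemma wedge_inner_commute: "wedge_inner f g = wedge_inner g f"
  by (simp add: wedge_inner_def mult.commute)

lemma wedge_inner_lincomb:
  assumes "wedge_C0 f" "wedge_C0 g" "wedge_C0 h"
  shows "wedge_inner (\<lambda>x. c * f x + g x) h = c * wedge_inner f h + wedge_inner g h"
  unfolding wedge_inner_def
  using integral_add[OF integrable_on_cmult_left[OF wedge_inner_integrable[OF assms(1,3)], of c] wedge_inner_integrable[OF assms(2,3)]]
  by (simp add: distrib_right mult.assoc)

text \<open>\<open>C\<close> is the L^1 norm of \<open>h\<close>: pairing with a fixed function is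
  continuous under uniform convergence, the mode in which functions are approximated by the
  span.\<close>

lemma wedge_inner_bound:
  assumes "wedge_C0 h"
  obtains C where "C \<ge> 0"
    "\<And>g e. wedge_C0 g \<Longrightarrow> (\<And>x. x \<in> wedge p \<Longrightarrow> \<bar>g x\<bar> \<le> e) \<Longrightarrow> 0 \<le> e \<Longrightarrow> \<bar>wedge_inner g h\<bar> \<le> C * e"
proof -
  define C where "C = integral (cbox (-1, - b) (1, b)) (\<lambda>z. \<bar>h (wedge_param z)\<bar>)"
  have ih: "(\<lambda>z. \<bar>h (wedge_param z)\<bar>) integrable_on cbox (-1, - b) (1, b)"
    using assms by (intro integrable_continuous continuous_on_rabs continuous_on_param) (auto simp: wedge_C0_def)
  have "C \<ge> 0" unfolding C_def by (intro integral_nonneg ih) auto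
  moreover have "\<bar>wedge_inner g h\<bar> \<le> C * e"
    if g: "wedge_C0 g" "\<And>x. x \<in> wedge p \<Longrightarrow> \<bar>g x\<bar> \<le> e" "0 \<le> e" for g e
  proof -
    have ge: "\<bar>g x\<bar> \<le> e" for x using g by (cases "x \<in> wedge p") (auto simp: wedge_C0_def)
    have "norm (wedge_inner g h) \<le> integral (cbox (-1, - b) (1, b)) (\<lambda>z. e * \<bar>h (wedge_param z)\<bar>)"
      unfolding wedge_inner_def
    proof (rule integral_norm_bound_integral)
      show "(\<lambda>z. g (wedge_param z) * h (wedge_param z)) integrable_on cbox (-1, - b) (1, b)"
        by (rule wedge_inner_integrable[OF g(1) assms])
      show "(\<lambda>z. e * \<bar>h (wedge_param z)\<bar>) integrable_on cbox (-1, - b) (1, b)"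
        using integrable_on_cmult_left[OF ih, of e] by simp
      show "norm (g (wedge_param z) * h (wedge_param z)) \<le> e * \<bar>h (wedge_param z)\<bar>" for z
        by (auto simp: abs_mult intro: mult_right_mono ge)
    qed
    thus ?thesis by (simp add: C_def mult.commute)
  qed
  ultimately show ?thesis using that by blast
qed

lemma wedge_inner_self_eq_0:
  assumes f: "wedge_C0 f" "wedge_inner f f = 0"
  shows "f = (\<lambda>_. 0)"
proof -
  have "continuous_on (cbox (-1, - b) (1, b)) (\<lambda>z. f (wedge_param z) * f (wedge_param z))"
    using f by (intro continuous_intros continuous_on_param) (auto simp: wedge_C0_def)
  moreover have "(0 :: real, 0) \<in> box (-1, - b) (1, b)" using half_angle by (simp add: mem_box_Pair)
  hence "box (-1 :: real, - b) (1, b) \<noteq> {}" by blast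
  ultimately have "\<forall>z\<in>cbox (-1, - b) (1, b). f (wedge_param z) * f (wedge_param z) = 0"
    using f(2) unfolding wedge_inner_def
    by (subst (asm) integral_cbox_eq_0_iff) auto
  hence "f (wedge_param z) = 0" if "z \<in> box (-1, - b) (1, b)" for z
    using that box_subset_cbox by auto
  hence "f x = 0" if "x \<in> wedge p" for x
    using that unfolding wedge_eq_param by blast
  thus ?thesis using f(1) by (auto simp: wedge_C0_def)
qed

definition eigenfun :: "nat \<Rightarrow> nat \<Rightarrow> real ^ 3 \<Rightarrow> real" where
  "eigenfun m j = wedge_fun (gegenbauer (p * m) j) m"

lemma wedge_C0_eigenfun: "m \<ge> 1 \<Longrightarrow> wedge_C0 (eigenfun m j)"
  unfolding eigenfun_def by (rule wedge_C0_wedge_fun)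

lemma wedge_inner_wedge_fun:
  assumes "m \<ge> 1" "m' \<ge> 1"
  shows "wedge_inner (wedge_fun q m) (wedge_fun r m') =
    integral {-1..1} (\<lambda>t. poly q t * poly r t * sqrt (1 - t\<^sup>2) ^ (p * m + p * m')) *
    integral {- b..b} (\<lambda>\<phi>. sin (real m * (real p * \<phi> + pi / 2)) * sin (real m' * (real p * \<phi> + pi / 2)))"
proof -
  let ?A = "\<lambda>t. poly q t * poly r t * sqrt (1 - t\<^sup>2) ^ (p * m + p * m')"
  let ?B = "\<lambda>\<phi>. sin (real m * (real p * \<phi> + pi / 2)) * sin (real m' * (real p * \<phi> + pi / 2))"
  have "wedge_inner (wedge_fun q m) (wedge_fun r m') = integral (cbox (-1, - b) (1, b)) (\<lambda>z :: real \<times> real. ?A (fst z) * ?B (snd z))"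
    unfolding wedge_inner_def
  proof (rule integral_cong)
    fix z :: "real \<times> real" assume "z \<in> cbox (-1, - b) (1, b)"
    hence "wedge_param z \<in> closure (wedge p)" unfolding closure_wedge_eq_param by blast
    thus "wedge_fun q m (wedge_param z) * wedge_fun r m' (wedge_param z) = ?A (fst z) * ?B (snd z)"
      using assms by (cases z) (simp add: wedge_fun_closure sector_param power_add)
  qed
  also have "\<dots> = integral (cbox (-1) 1) (\<lambda>t. integral (cbox (- b) b) (\<lambda>\<phi>. ?A t * ?B \<phi>))"
    by (subst integral_prod_continuous) (auto intro!: continuous_intros)
  also have "\<dots> = integral {-1..1} ?A * integral {- b..b} ?B"
    by simp
  finally show ?thesis .
qed

text \<open>For \<open>m = m'\<close> the two sector factors supply exactly the Gegenbauer weight;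
  for different frequencies the sines are orthogonal over the opening angle. Symmetry of the
  Laplacian would not separate pairs with p m + j = p m' + j', which share their eigenvalue.\<close>

lemma wedge_inner_eigenfun_orthogonal:
  assumes "m \<ge> 1" "m' \<ge> 1" "(m, j) \<noteq> (m', j')"
  shows "wedge_inner (eigenfun m j) (eigenfun m' j') = 0"
proof (cases "m = m'")
  case True
  hence j: "j \<noteq> j'" using assms by simp
  have "integral {-1..1} (\<lambda>t. poly (gegenbauer (p * m) j) t * poly (gegenbauer (p * m) j') t * sqrt (1 - t\<^sup>2) ^ (p * m + p * m))
      = integral {-1..1} (\<lambda>t. poly (gegenbauer (p * m) j) t * poly (gegenbauer (p * m) j') t * (1 - t\<^sup>2) ^ (p * m))"
  proof (rule integral_cong)
    fix t :: real assume "t \<in> {-1..1}"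
    hence "t\<^sup>2 \<le> 1" by (simp add: abs_square_le_1 abs_le_iff)
    hence "sqrt (1 - t\<^sup>2) ^ (p * m + p * m) = (1 - t\<^sup>2) ^ (p * m)"
      by (simp add: power_add flip: power_mult_distrib)
    thus "poly (gegenbauer (p * m) j) t * poly (gegenbauer (p * m) j') t * sqrt (1 - t\<^sup>2) ^ (p * m + p * m) =
        poly (gegenbauer (p * m) j) t * poly (gegenbauer (p * m) j') t * (1 - t\<^sup>2) ^ (p * m)" by simp
  qed
  also have "\<dots> = 0" using j by (rule gegenbauer_orthogonal)
  finally show ?thesis using assms True by (simp add: eigenfun_def wedge_inner_wedge_fun)
next
  case False
  let ?\<theta> = "\<lambda>\<phi>. real p * \<phi> + pi / 2"
  have "sin (real m * ?\<theta> \<phi>) * sin (real m' * ?\<theta> \<phi>) =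
      (1 / 2) * cos ((real m - real m') * ?\<theta> \<phi>) - (1 / 2) * cos ((real m + real m') * ?\<theta> \<phi>)" for \<phi>
    by (simp only: left_diff_distrib distrib_right sin_times_sin) (simp add: diff_divide_distrib)
  moreover have "((\<lambda>\<phi>. (1 / 2) * cos ((real m - real m') * ?\<theta> \<phi>) - (1 / 2) * cos ((real m + real m') * ?\<theta> \<phi>))
      has_integral (1 / 2) * 0 - (1 / 2) * 0) {- b..b}"
    unfolding b_def using p assms False
    by (intro has_integral_diff has_integral_mult_right integral_cos_affine_eq_0)
       (auto simp: left_diff_distrib distrib_right sin_diff sin_add)
  ultimately have "integral {- b..b} (\<lambda>\<phi>. sin (real m * ?\<theta> \<phi>) * sin (real m' * ?\<theta> \<phi>)) = 0"
    by (simp only: integral_unique)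
  thus ?thesis using assms by (simp add: eigenfun_def wedge_inner_wedge_fun)
qed

lemma wedge_inner_eigenfun_self_nonzero:
  assumes m: "m \<ge> 1"
  shows "wedge_inner (eigenfun m j) (eigenfun m j) \<noteq> 0"
proof
  assume "wedge_inner (eigenfun m j) (eigenfun m j) = 0"
  hence zero: "eigenfun m j = (\<lambda>_. 0)" using wedge_inner_self_eq_0 wedge_C0_eigenfun[OF m] by blast
  let ?G = "gegenbauer (p * m) j"
  have "infinite ({-1<..<1::real} - {t. poly ?G t = 0})"
    using poly_roots_finite[OF gegenbauer_nonzero] by (intro Diff_infinite_finite) auto
  then obtain t where "t \<in> {-1<..<1::real} - {t. poly ?G t = 0}"
    using infinite_imp_nonempty by blast
  hence t: "-1 < t" "t < 1" "poly ?G t \<noteq> 0" by auto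
  \<comment> \<open>Chosen so that the argument of the sine is \<open>pi / 2\<close>; with
    \<open>t\<close> off the finitely many roots of the polynomial, the eigenfunction is nonzero at
    this point.\<close>
  define \<phi> where "\<phi> = (pi / (2 * real m) - pi / 2) / real p"
  have th: "real p * \<phi> + pi / 2 = pi / (2 * real m)" using p by (simp add: \<phi>_def)
  have pb: "real p * b = pi / 2" using p by (simp add: b_def)
  have "0 < real p * \<phi> + pi / 2" "real p * \<phi> + pi / 2 < pi"
    unfolding th using m by (auto simp: field_simps)
  moreover have "real p * (- b) = - (pi / 2)" using pb by simp
  ultimately have "real p * (- b) < real p * \<phi>" "real p * \<phi> < real p * b" using pb by linarith+
  hence "- b < \<phi>" "\<phi> < b" unfolding mult_less_cancel_left by auto
  hence W: "wedge_param (t, \<phi>) \<in> wedge p"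
    using t unfolding wedge_eq_param by (intro imageI) (simp add: mem_box_Pair)
  have "\<bar>t\<bar> < 1" using t by auto
  hence "t\<^sup>2 < 1" by (simp add: abs_square_less_1)
  moreover have "real m * (pi / (2 * real m)) = pi / 2" using m by simp
  ultimately have "eigenfun m j (wedge_param (t, \<phi>)) \<noteq> 0"
    using W t(3) m unfolding eigenfun_def wedge_fun_def sector_param th by simp
  thus False using zero by simp
qed

end

subsection \<open>Enumeration of the eigenvalues\<close>

text \<open>Sum p (j div p) \<le> j over j. This is the arithmetic core of the eigenvalue
  inequality, since the left-hand sum counts the eigenvalues up to l (l + 1).\<close>

lemma sum_div_le: "2 * p * (\<Sum>j<Suc l. j div p) \<le> l * (l + 1)" for p l :: nat
proof (induction l)
  case (Suc l)
  have "p * (Suc l div p) \<le> Suc l" by simp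
  hence "2 * p * (Suc l div p) \<le> 2 * Suc l" by (metis mult.assoc mult_le_mono2)
  moreover have "2 * p * (\<Sum>j<Suc (Suc l). j div p) = 2 * p * (\<Sum>j<Suc l. j div p) + 2 * p * (Suc l div p)"
    by (simp only: sum.lessThan_Suc distrib_left)
  ultimately show ?case using Suc by simp
qed simp

text \<open>\<open>N l\<close> counts the eigenvalues strictly below level \<open>l\<close>, so the
  level of index \<open>i\<close> is determined by \<open>N (L i) \<le> i < N (Suc (L i))\<close>.
  The last claim is \<open>sum_div_le\<close> at that level; it has \<open>Suc i\<close> because
  indices start at 0.\<close>

lemma exists_enumeration_with_multiplicities:
  fixes p :: nat
  assumes p: "p \<ge> 1"
  obtains L :: "nat \<Rightarrow> nat" where "mono L" "\<And>l. finite {i. L i = l}"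
    "\<And>l. card {i. L i = l} = l div p" "\<And>i. 2 * p * Suc i \<le> L i * (L i + 1)"
proof -
  define N where "N l = (\<Sum>j<l. j div p)" for l
  have N_Suc: "N (Suc l) = N l + l div p" for l by (simp add: N_def)
  have N_mono: "N a \<le> N b" if "a \<le> b" for a b
    using that by (rule lift_Suc_mono_le[of N, rotated]) (simp add: N_Suc)
  \<comment> \<open>Every positive multiple of \<open>p\<close> is a level that contributes at least
    one eigenvalue.\<close>
  have N_unbounded: "i < N (Suc ((i + 1) * p))" for i
  proof (induction i)
    case 0 thus ?case using p by (simp add: N_Suc)
  next
    case (Suc i)
    have "N (Suc ((i + 1) * p)) \<le> N ((Suc i + 1) * p)" using p by (intro N_mono) simp
    moreover have "((Suc i + 1) * p) div p \<ge> 1" using p by simp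
    ultimately show ?case using Suc unfolding N_Suc[of "(Suc i + 1) * p"] by linarith
  qed
  define L where "L i = (LEAST l. i < N (Suc l))" for i
  have L1: "i < N (Suc (L i))" for i unfolding L_def by (rule LeastI, rule N_unbounded)
  have L2: "N (L i) \<le> i" for i
  proof (cases "L i")
    case (Suc l)
    have "\<not> i < N (Suc l)" using not_less_Least[of l "\<lambda>l. i < N (Suc l)"] Suc L_def by simp
    thus ?thesis using Suc by simp
  qed (simp add: N_def)
  have fib: "{i. L i = l} = {N l..<N (Suc l)}" for l
  proof (intro equalityI subsetI)
    fix i assume i: "i \<in> {N l..<N (Suc l)}"
    have "L i \<le> l" unfolding L_def by (rule Least_le) (use i in simp)
    moreover have "\<not> L i < l" using N_mono[of "Suc (L i)" l] L1[of i] i by auto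
    ultimately show "i \<in> {i. L i = l}" by simp
  qed (use L1 L2 in auto)
  show ?thesis
  proof
    show "mono L"
    proof
      fix i j :: nat assume "i \<le> j"
      hence "i < N (Suc (L j))" using L1[of j] by simp
      thus "L i \<le> L j" unfolding L_def[of i] by (rule Least_le)
    qed
    show "finite {i. L i = l}" for l by (simp add: fib)
    show "card {i. L i = l} = l div p" for l by (simp add: fib N_Suc)
    show "2 * p * Suc i \<le> L i * (L i + 1)" for i
      using sum_div_le[of p "L i"] L1[of i] mult_le_mono2[of "Suc i" "N (Suc (L i))" "2 * p"]
      unfolding N_def by linarith
  qed
qed

subsection \<open>Completeness of the eigenfunctions\<close>

text \<open>A positive maximum over the closure lies in \<open>M\<close>, as \<open>w\<close>
  vanishes elsewhere; there the Laplacian is at most 0 and the zero-order term alone is bounded by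
  \<open>K\<close>. A maximum that is not positive is covered by \<open>K \<ge> 0\<close>.\<close>

lemma sphere_maximum_principle:
  fixes M :: "'a::euclidean_space set"
  assumes op: "open (sgn -` M)" and M: "M \<subseteq> sphere 0 1"
    and C2: "C2_on (sgn -` M) (w \<circ> sgn)" and cont: "continuous_on (closure M) w"
    and off: "\<And>x. x \<notin> M \<Longrightarrow> w x = 0"
    and c: "c > 0" and K: "K \<ge> 0" "\<And>x. x \<in> M \<Longrightarrow> c * w x - laplace_beltrami w x \<le> K"
  shows "w x \<le> K / c"
proof (cases "x \<in> M")
  case False
  thus ?thesis using off c K by simp
next
  case True
  have "compact (closure M)" using bounded_subset[OF bounded_sphere M] by (simp add: compact_closure)
  moreover have "closure M \<noteq> {}" using True closure_subset by blast
  ultimately obtain x0 where x0: "x0 \<in> closure M" "\<And>y. y \<in> closure M \<Longrightarrow> w y \<le> w x0"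
    using continuous_attains_sup[OF _ _ cont] by blast
  have sub: "y \<in> M \<Longrightarrow> y \<in> closure M" for y using closure_subset by blast
  have "w x0 \<le> K / c"
  proof (cases "w x0 \<le> 0")
    case True
    moreover have "0 \<le> K / c" using c K by simp
    ultimately show ?thesis by linarith
  next
    case False
    hence x0M: "x0 \<in> M" using off by force
    hence sx: "sgn x0 = x0" using M by (auto simp: sgn_div_norm)
    have "laplace_beltrami w x0 = laplacian (w \<circ> sgn) x0"
      by (rule laplace_beltrami_eq_laplacian[OF op M x0M C2])
    also have "\<dots> \<le> 0"
      by (rule laplacian_nonpos_at_max[OF op _ C2]) (use x0M sx x0(2) sub in auto)
    finally have "c * w x0 \<le> K" using K(2)[OF x0M] by linarith
    thus ?thesis using c by (simp add: field_simps)
  qed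
  thus ?thesis using x0(2)[of x] True sub by force
qed

lemma eq_0_if_le_mult_eps:
  fixes a C :: real
  assumes "C \<ge> 0" "\<And>e. e > 0 \<Longrightarrow> \<bar>a\<bar> \<le> C * e"
  shows "a = 0"
proof (rule ccontr)
  assume "a \<noteq> 0"
  hence "\<bar>a\<bar> \<le> C * (\<bar>a\<bar> / (C + 1))" using assms by (intro assms(2)) auto
  thus False using \<open>a \<noteq> 0\<close> assms(1) by (simp add: field_simps)
qed

lemma sum_fun_eq: "(\<Sum>i\<in>A. (\<lambda>x. f i x)) = (\<lambda>x. \<Sum>i\<in>A. f i x)"
  for f :: "'i \<Rightarrow> 'a \<Rightarrow> real"
  by (induction A rule: infinite_finite_induct) (auto simp: fun_eq_iff)

context wedge_geometry
begin

section \<open>Regular functions and the explicit eigenfunctions\<close>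

definition regular :: "(real ^ 3 \<Rightarrow> real) \<Rightarrow> bool" where
  "regular f \<longleftrightarrow> C2_on (sgn -` wedge p) (f \<circ> sgn) \<and> wedge_C0 f"

definition eigenval :: "nat \<Rightarrow> nat \<Rightarrow> real" where
  "eigenval m j = real ((p * m + j) * (p * m + j + 1))"

definition eigenfuns :: "(real ^ 3 \<Rightarrow> real) set" where
  "eigenfuns = {eigenfun m j |m j. m \<ge> 1}"

lemma eigenval_nonneg: "eigenval m j \<ge> 0"
  by (simp add: eigenval_def)

lemma dirichlet_eigenspace_wedge:
  "dirichlet_eigenspace (wedge p) \<mu> =
     {u. regular u \<and> (\<forall>x\<in>wedge p. - laplace_beltrami u x = \<mu> * u x)}"
  by (auto simp: dirichlet_eigenspace_def regular_def wedge_C0_def)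

lemma regular_lincomb:
  assumes "regular f" "regular g"
  shows "regular (\<lambda>x. c * f x + g x)"
    and "x \<in> wedge p \<Longrightarrow>
      laplace_beltrami (\<lambda>x. c * f x + g x) x = c * laplace_beltrami f x + laplace_beltrami g x"
proof -
  have f: "C2_on (sgn -` wedge p) (f \<circ> sgn)" and g: "C2_on (sgn -` wedge p) (g \<circ> sgn)"
    using assms by (auto simp: regular_def)
  have eq: "(\<lambda>x. c * f x + g x) \<circ> sgn = (\<lambda>x. c * (f \<circ> sgn) x + (g \<circ> sgn) x)" by auto
  have C2: "C2_on (sgn -` wedge p) ((\<lambda>x. c * f x + g x) \<circ> sgn)"
    unfolding eq by (intro C2_on_add C2_on_cmult f g)
  thus "regular (\<lambda>x. c * f x + g x)"
    using assms by (simp add: regular_def wedge_C0_lincomb)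
  assume x: "x \<in> wedge p"
  hence "x \<in> sgn -` wedge p" using wedge_subset_sphere by (auto simp: sgn_div_norm)
  note pt = open_sgn_vimage_wedge this
  note lb = laplace_beltrami_eq_laplacian[OF open_sgn_vimage_wedge wedge_subset_sphere x]
  show "laplace_beltrami (\<lambda>x. c * f x + g x) x = c * laplace_beltrami f x + laplace_beltrami g x"
    unfolding lb[OF C2] lb[OF f] lb[OF g] eq
    by (subst laplacian_add[OF pt C2_on_cmult[OF f] g], subst laplacian_cmult[OF pt f]) simp
qed

lemma regular_wedge_C0: "regular f \<Longrightarrow> wedge_C0 f"
  by (simp add: regular_def)

lemma regular_zero: "regular (\<lambda>_. 0)"
  by (auto simp: regular_def wedge_C0_def comp_def)

lemma laplace_beltrami_zero: "x \<in> wedge p \<Longrightarrow> laplace_beltrami (\<lambda>_. 0) x = 0"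
  using regular_lincomb(2)[OF regular_zero regular_zero, of x 1] by simp

lemma eigenfun_regular:
  assumes m: "m \<ge> 1"
  shows "regular (eigenfun m j)"
    and "x \<in> wedge p \<Longrightarrow> laplace_beltrami (eigenfun m j) x = - eigenval m j * eigenfun m j x"
proof -
  let ?F = "\<lambda>x. poly (gegenbauer (p * m) j) (sgn x $ 1) *
    (Im (\<i> ^ m) * Re (zcoord (sgn x) ^ (p * m)) + Re (\<i> ^ m) * Im (zcoord (sgn x) ^ (p * m)))"
  have eq: "?F x = (eigenfun m j \<circ> sgn) x" if "x \<in> sgn -` wedge p" for x
    using that by (simp add: eigenfun_def wedge_fun_def sector_eq)
  have "sgn -` wedge p \<subseteq> - {0}" by (auto simp: wedge_def)
  hence F: "C2_on (sgn -` wedge p) ?F"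
    using C2_on_subset[OF C2_on_eigenfunction] by blast
  have C2: "C2_on (sgn -` wedge p) (eigenfun m j \<circ> sgn)"
    by (rule C2_on_cong[OF open_sgn_vimage_wedge eq F])
  thus "regular (eigenfun m j)" using wedge_C0_eigenfun[OF m] by (simp add: regular_def)
  assume x: "x \<in> wedge p"
  hence nx: "norm x = 1" using wedge_subset_sphere by auto
  hence "x \<in> sgn -` wedge p" using x by (simp add: sgn_div_norm)
  from laplacian_cong[OF open_sgn_vimage_wedge eq F this]
  have "laplacian (eigenfun m j \<circ> sgn) x = laplacian ?F x" .
  also have "\<dots> = - eigenval m j * eigenfun m j x"
    unfolding laplacian_eigenfunction[OF nx] using x
    by (simp add: eigenfun_def wedge_fun_def sector_eq eigenval_def)
  finally show "laplace_beltrami (eigenfun m j) x = - eigenval m j * eigenfun m j x"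
    unfolding laplace_beltrami_eq_laplacian[OF open_sgn_vimage_wedge wedge_subset_sphere x C2] .
qed

text \<open>Span induction in pointwise form, matched to the lemmas about functions
  \<open>c * f x + g x\<close>.\<close>

lemma span_eigenfuns_induct [consumes 1, case_names zero step]:
  assumes "q \<in> fun_vs.span eigenfuns"
    and "P (\<lambda>_. 0)"
    and "\<And>c m j f. m \<ge> 1 \<Longrightarrow> P f \<Longrightarrow> P (\<lambda>x. c * eigenfun m j x + f x)"
  shows "P q"
  using assms(1)
proof (induction rule: fun_vs.span_induct_alt)
  case base
  show ?case using assms(2) by (simp add: zero_fun_def)
next
  case (step c y f)
  then obtain m j where "y = eigenfun m j" "m \<ge> 1" by (auto simp: eigenfuns_def)
  thus ?case using assms(3)[OF _ step.IH, of m c j] by (simp add: plus_fun_def)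
qed

section \<open>Uniform density of the span of the eigenfunctions\<close>

lemma wedge_fun_add: "wedge_fun (q + r) m = wedge_fun q m + wedge_fun r m"
  by (auto simp: wedge_fun_def fun_eq_iff algebra_simps)

lemma wedge_fun_smult: "wedge_fun (smult c q) m = (\<lambda>x. c * wedge_fun q m x)"
  by (auto simp: wedge_fun_def fun_eq_iff)

text \<open>The Gegenbauer polynomials of a fixed index span all polynomials. For
  \<open>m = 0\<close> the sector factor is 0; this case arises from the lowered frequency in
  \<open>multiplier_cosector\<close>.\<close>

lemma wedge_fun_in_span: "wedge_fun q m \<in> fun_vs.span eigenfuns"
proof (cases "m = 0")
  case True
  hence "wedge_fun q m = 0" by (auto simp: wedge_fun_def sector_def fun_eq_iff)
  thus ?thesis using fun_vs.span_zero by simp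
next
  case False
  obtain c where c: "q = (\<Sum>j<Suc (degree q). smult (c j) (gegenbauer (p * m) j))"
    using poly_eq_sum_gegenbauer[of q "Suc (degree q)"] by blast
  have "wedge_fun (\<Sum>j<d. smult (c j) (gegenbauer (p * m) j)) m \<in> fun_vs.span eigenfuns" for d
  proof (induction d)
    case 0
    have "wedge_fun 0 m = (\<lambda>_. 0)" by (auto simp: wedge_fun_def fun_eq_iff)
    thus ?case using fun_vs.span_zero[of eigenfuns] by (simp add: zero_fun_def)
  next
    case (Suc d)
    have "eigenfun m d \<in> eigenfuns" using False by (auto simp: eigenfuns_def)
    hence "(\<lambda>x. c d * eigenfun m d x) \<in> fun_vs.span eigenfuns"
      by (intro fun_vs.span_scale fun_vs.span_base)
    from fun_vs.span_add[OF Suc this] show ?case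
      by (simp only: sum.lessThan_Suc wedge_fun_add wedge_fun_smult eigenfun_def)
  qed
  thus ?thesis by (subst c)
qed

text \<open>The span contains no nonzero constants on the wedge, since its members vanish on the
  boundary. Its continuous multipliers do form an algebra with constants, to which
  Stone--Weierstrass applies.\<close>

definition multiplier :: "(real ^ 3 \<Rightarrow> real) \<Rightarrow> bool" where
  "multiplier g \<longleftrightarrow> continuous_on (closure (wedge p)) g \<and>
     (\<forall>v\<in>fun_vs.span eigenfuns. (\<lambda>x. g x * v x) \<in> fun_vs.span eigenfuns)"

lemma multiplierI:
  assumes "continuous_on (closure (wedge p)) g"
    and "\<And>q m. m \<ge> 1 \<Longrightarrow> (\<lambda>x. g x * wedge_fun q m x) \<in> fun_vs.span eigenfuns"
  shows "multiplier g"
proof -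
  have "(\<lambda>x. g x * v x) \<in> fun_vs.span eigenfuns" if "v \<in> fun_vs.span eigenfuns" for v
    using that
  proof (induction rule: span_eigenfuns_induct)
    case zero
    thus ?case using fun_vs.span_zero[of eigenfuns] by (simp add: zero_fun_def)
  next
    case (step c m j f)
    have "(\<lambda>x. g x * (c * eigenfun m j x + f x)) = (\<lambda>x. c * (g x * eigenfun m j x)) + (\<lambda>x. g x * f x)"
      by (auto simp: fun_eq_iff algebra_simps)
    thus ?case
      using fun_vs.span_add[OF fun_vs.span_scale[OF assms(2)[OF step(1)]] step(2), of c "gegenbauer (p * m) j"]
      by (simp add: eigenfun_def)
  qed
  thus ?thesis using assms(1) by (simp add: multiplier_def)
qed

lemma multiplier_continuous: "multiplier f \<Longrightarrow> continuous_on (closure (wedge p)) f"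
  by (simp add: multiplier_def)

lemma multiplier_const: "multiplier (\<lambda>_. c)"
  unfolding multiplier_def using fun_vs.span_scale by auto

lemma multiplier_add:
  assumes "multiplier f" "multiplier g"
  shows "multiplier (\<lambda>x. f x + g x)"
  unfolding multiplier_def
proof (intro conjI ballI)
  show "continuous_on (closure (wedge p)) (\<lambda>x. f x + g x)"
    using assms by (intro continuous_on_add) (simp_all add: multiplier_def)
  fix v assume "v \<in> fun_vs.span eigenfuns"
  hence "(\<lambda>x. f x * v x) + (\<lambda>x. g x * v x) \<in> fun_vs.span eigenfuns"
    using assms by (intro fun_vs.span_add) (simp_all add: multiplier_def)
  moreover have "(\<lambda>x. f x * v x) + (\<lambda>x. g x * v x) = (\<lambda>x. (f x + g x) * v x)"
    by (simp add: fun_eq_iff distrib_right)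
  ultimately show "(\<lambda>x. (f x + g x) * v x) \<in> fun_vs.span eigenfuns" by (simp only:)
qed

lemma multiplier_mult:
  assumes "multiplier f" "multiplier g"
  shows "multiplier (\<lambda>x. f x * g x)"
  unfolding multiplier_def
proof (intro conjI ballI)
  show "continuous_on (closure (wedge p)) (\<lambda>x. f x * g x)"
    using assms by (intro continuous_on_mult) (simp_all add: multiplier_def)
  fix v assume "v \<in> fun_vs.span eigenfuns"
  hence "(\<lambda>x. g x * v x) \<in> fun_vs.span eigenfuns" using assms(2) by (simp add: multiplier_def)
  hence "(\<lambda>x. f x * (g x * v x)) \<in> fun_vs.span eigenfuns"
    using assms(1) unfolding multiplier_def by (elim conjE) (erule bspec)
  thus "(\<lambda>x. f x * g x * v x) \<in> fun_vs.span eigenfuns" by (simp only: mult.assoc)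
qed

lemma multiplier_coord: "multiplier (\<lambda>x. x $ 1)"
proof (rule multiplierI)
  fix q and m :: nat
  have "(\<lambda>x. x $ 1 * wedge_fun q m x) = wedge_fun ([:0, 1:] * q) m"
    by (auto simp: wedge_fun_def fun_eq_iff)
  thus "(\<lambda>x. x $ 1 * wedge_fun q m x) \<in> fun_vs.span eigenfuns"
    using wedge_fun_in_span by simp
qed (intro continuous_intros)

definition cosector :: "real ^ 3 \<Rightarrow> real" where
  "cosector x = Re (\<i> * zcoord x ^ p)"

text \<open>Multiply \<zeta>^m by 2 Re \<zeta> = \<zeta> + cnj \<zeta>: a homogeneous form of the
  product-to-sum formula. On the sphere the squared modulus of \<zeta> is a polynomial in x_1, which
  keeps the product inside the span.\<close>

lemma cosector_mult_sector:
  assumes x: "x \<in> wedge p" and m: "m \<ge> 1"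
  shows "cosector x * sector m x = (sector (m + 1) x + (1 - (x $ 1)\<^sup>2) ^ p * sector (m - 1) x) / 2"
proof -
  let ?\<zeta> = "\<i> * zcoord x ^ p"
  obtain n where n: "m = Suc n" using m by (cases m) auto
  have "x \<bullet> x = 1" using x by (simp add: wedge_def norm_eq_1)
  hence "(x $ 3)\<^sup>2 + (x $ 2)\<^sup>2 = 1 - (x $ 1)\<^sup>2" by (simp add: inner_vec_def sum_3 power2_eq_square)
  hence "(cmod (zcoord x))\<^sup>2 = 1 - (x $ 1)\<^sup>2" by (simp add: zcoord_def cmod_power2)
  hence "(cmod ?\<zeta>)\<^sup>2 = (1 - (x $ 1)\<^sup>2) ^ p"
    by (simp add: norm_mult norm_power flip: power_mult) (simp add: power_mult mult.commute[of p])
  hence sq: "?\<zeta> * cnj ?\<zeta> = of_real ((1 - (x $ 1)\<^sup>2) ^ p)" by (simp only: complex_norm_square[symmetric])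
  have "of_real (2 * Re ?\<zeta>) * ?\<zeta> ^ m = (?\<zeta> + cnj ?\<zeta>) * ?\<zeta> ^ m"
    by (simp only: complex_add_cnj)
  also have "\<dots> = ?\<zeta> ^ (m + 1) + (?\<zeta> * cnj ?\<zeta>) * ?\<zeta> ^ (m - 1)"
    unfolding n by (simp add: algebra_simps)
  finally have "Im (of_real (2 * Re ?\<zeta>) * ?\<zeta> ^ m)
      = Im (?\<zeta> ^ (m + 1) + of_real ((1 - (x $ 1)\<^sup>2) ^ p) * ?\<zeta> ^ (m - 1))"
    unfolding sq by (rule arg_cong)
  moreover have "Im (of_real a * z) = a * Im z" for a z by simp
  ultimately have "2 * (cosector x * sector m x) = sector (m + 1) x + (1 - (x $ 1)\<^sup>2) ^ p * sector (m - 1) x"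
    unfolding cosector_def sector_def plus_complex.sel by (simp only: mult.assoc)
  thus ?thesis by (metis nonzero_mult_div_cancel_left zero_neq_numeral)
qed

lemma multiplier_cosector: "multiplier cosector"
proof (rule multiplierI)
  show "continuous_on (closure (wedge p)) cosector"
    unfolding cosector_def zcoord_def Complex_eq by (intro continuous_intros)
  fix q and m :: nat assume m: "m \<ge> 1"
  have "(\<lambda>x. cosector x * wedge_fun q m x)
      = wedge_fun (smult (1 / 2) q) (m + 1) + wedge_fun (smult (1 / 2) ([:1, 0, -1:] ^ p * q)) (m - 1)"
  proof
    fix x
    have "poly q (x $ 1) * (cosector x * sector m x) =
       poly q (x $ 1) * ((sector (m + 1) x + (1 - (x $ 1)\<^sup>2) ^ p * sector (m - 1) x) / 2)"
      if "x \<in> wedge p" using cosector_mult_sector[OF that m] by simp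
    thus "cosector x * wedge_fun q m x =
      (wedge_fun (smult (1 / 2) q) (m + 1) + wedge_fun (smult (1 / 2) ([:1, 0, -1:] ^ p * q)) (m - 1)) x"
      by (auto simp: wedge_fun_def power2_eq_square field_simps)
  qed
  thus "(\<lambda>x. cosector x * wedge_fun q m x) \<in> fun_vs.span eigenfuns"
    using fun_vs.span_add[OF wedge_fun_in_span wedge_fun_in_span] by simp
qed

lemma cosector_param:
  "cosector (wedge_param (t, \<phi>)) = sqrt (1 - t\<^sup>2) ^ p * cos (real p * \<phi> + pi / 2)"
  by (simp add: cosector_def zcoord_wedge_param power_mult_distrib Complex.DeMoivre cos_add)

text \<open>Equal first coordinates fix \<open>t\<close>, and the cosine is injective on the range
  [0, pi] of the opened angle. At a pole the angle is undetermined, but the point is the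
  same.\<close>

lemma separating:
  assumes "x \<in> closure (wedge p)" "y \<in> closure (wedge p)" "x $ 1 = y $ 1" "cosector x = cosector y"
  shows "x = y"
proof -
  obtain t \<phi> where x: "x = wedge_param (t, \<phi>)" and \<phi>: "\<phi> \<in> {- b..b}"
    using assms(1) unfolding closure_wedge_eq_param by auto
  obtain t' \<phi>' where y: "y = wedge_param (t', \<phi>')" and \<phi>': "\<phi>' \<in> {- b..b}"
    using assms(2) unfolding closure_wedge_eq_param by auto
  have t: "t' = t" using assms(3) x y by simp
  show ?thesis
  proof (cases "sqrt (1 - t\<^sup>2) = 0")
    case True
    thus ?thesis unfolding x y t vec_eq_iff forall_3 by simp
  next
    case False
    hence "cos (real p * \<phi> + pi / 2) = cos (real p * \<phi>' + pi / 2)"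
      using assms(4) unfolding x y t cosector_param by simp
    hence "real p * \<phi> + pi / 2 = real p * \<phi>' + pi / 2"
      using angle_range(1)[OF \<phi>] angle_range(1)[OF \<phi>'] cos_inj_pi by blast
    thus ?thesis using p unfolding x y t by simp
  qed
qed

lemma span_eigenfuns_dense:
  assumes f: "wedge_C0 f" and e: "e > 0"
  obtains q where "q \<in> fun_vs.span eigenfuns" "\<And>x. x \<in> wedge p \<Longrightarrow> \<bar>f x - q x\<bar> \<le> e"
proof -
  let ?K = "closure (wedge p)"
  define T where "T = {x \<in> ?K. \<bar>f x\<bar> \<ge> e / 2}"
  have contf: "continuous_on ?K f" using f by (simp add: wedge_C0_def)
  have "T = ?K \<inter> (\<lambda>x. \<bar>f x\<bar>) -` {e / 2..}" by (auto simp: T_def)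
  moreover have "closed (?K \<inter> (\<lambda>x. \<bar>f x\<bar>) -` {e / 2..})"
    by (intro continuous_closed_preimage continuous_intros contf) auto
  ultimately have "closed T" by simp
  hence cT: "compact T"
    using compact_closure_wedge compact_Int_closed[of ?K T] by (simp add: T_def Int_absorb1)
  have TW: "T \<subseteq> wedge p" using f e by (auto simp: T_def wedge_C0_def)
  \<comment> \<open>\<open>T\<close> is compact and lies in the open wedge, where the sector
    function is positive; its minimum on \<open>T\<close> will bound a denominator from
    below.\<close>
  obtain d where d: "d > 0" "\<And>x. x \<in> T \<Longrightarrow> d \<le> sector 1 x"
  proof (cases "T = {}")
    case False
    then obtain x0 where "x0 \<in> T" "\<And>x. x \<in> T \<Longrightarrow> sector 1 x0 \<le> sector 1 x"
      using continuous_attains_inf[OF cT False continuous_on_sector] by blast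
    thus ?thesis using that[of "sector 1 x0"] sector_1_pos TW by blast
  qed (use that[of 1] in auto)
  \<comment> \<open>\<open>v\<close> vanishes near the boundary, so its quotient by the sector function is continuous; the
    Stone--Weierstrass theorem is applied to this quotient.\<close>
  define v where "v x = f x - max (- (e / 2)) (min (e / 2) (f x))" for x
  define h where "h x = v x / max (sector 1 x) d" for x
  have fv: "\<bar>f x - v x\<bar> \<le> e / 2" for x using e by (auto simp: v_def)
  have hv: "sector 1 x * h x = v x" if "x \<in> ?K" for x
  proof (cases "x \<in> T")
    case True
    thus ?thesis using d by (auto simp: h_def max_def dest!: d(2))
  next
    case False
    hence "v x = 0" using that by (auto simp: v_def T_def)
    thus ?thesis by (simp add: h_def)
  qed
  have conth: "continuous_on ?K h"
    unfolding h_def v_def using d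
    by (intro continuous_intros contf continuous_on_sector) (auto simp: max_def)
  have "bounded (sector 1 ` ?K)"
    by (intro compact_imp_bounded compact_continuous_image continuous_on_sector compact_closure_wedge)
  then obtain B where B: "B > 0" "\<And>x. x \<in> ?K \<Longrightarrow> \<bar>sector 1 x\<bar> \<le> B"
    unfolding bounded_pos by auto
  have "\<exists>g. multiplier g \<and> (\<forall>x\<in>?K. \<bar>h x - g x\<bar> < e / (2 * B))"
  proof (rule Stone_Weierstrass_HOL[OF compact_closure_wedge _ _ _ _ _ conth])
    fix x y assume "x \<in> ?K \<and> y \<in> ?K \<and> x \<noteq> y"
    hence "x $ 1 \<noteq> y $ 1 \<or> cosector x \<noteq> cosector y" using separating by blast
    thus "\<exists>f. multiplier f \<and> f x \<noteq> f y" using multiplier_coord multiplier_cosector by blast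
  next
    show "0 < e / (2 * B)" using B e by simp
  next
    fix f g assume "multiplier f \<and> multiplier g"
    thus "multiplier (\<lambda>x. f x + g x)" "multiplier (\<lambda>x. f x * g x)"
      by (blast intro: multiplier_add, blast intro: multiplier_mult)
  qed (fact multiplier_const multiplier_continuous)+
  then obtain g where g: "multiplier g" "\<And>x. x \<in> ?K \<Longrightarrow> \<bar>h x - g x\<bar> < e / (2 * B)" by blast
  \<comment> \<open>\<open>wedge_fun 1 1\<close> is \<open>sector 1\<close> extended by zero.
    Multiplying by it brings the error e / (2 B) to at most e / 2; the other half is the truncation
    error.\<close>
  define q where "q x = g x * wedge_fun 1 1 x" for x
  have "q \<in> fun_vs.span eigenfuns"
    using g(1) wedge_fun_in_span unfolding q_def multiplier_def by blast
  moreover have "\<bar>f x - q x\<bar> \<le> e" if "x \<in> wedge p" for x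
  proof -
    have xK: "x \<in> ?K" using that closure_subset by blast
    have "v x - q x = sector 1 x * (h x - g x)"
      using hv[OF xK] wedge_fun_closure[OF _ xK, of 1 1] by (simp add: q_def algebra_simps)
    hence "\<bar>v x - q x\<bar> \<le> B * (e / (2 * B))"
      using B(1) B(2)[OF xK] g(2)[OF xK] by (simp only: abs_mult) (intro mult_mono, auto)
    hence "\<bar>v x - q x\<bar> \<le> e / 2" using B(1) by simp
    thus ?thesis using fv[of x] by linarith
  qed
  ultimately show ?thesis by (rule that)
qed

lemma span_eigenfuns_regular: "q \<in> fun_vs.span eigenfuns \<Longrightarrow> regular q"
proof (induction rule: span_eigenfuns_induct)
  case zero
  show ?case by (rule regular_zero)
next
  case (step c m j f)
  thus ?case by (intro regular_lincomb(1) eigenfun_regular(1))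
qed

section \<open>The resolvent and orthogonality of eigenspaces\<close>

lemma wedge_inner_zero [simp]: "wedge_inner (\<lambda>_. 0) h = 0"
  by (simp add: wedge_inner_def)

text \<open>On the span the resolvent divides each coefficient by \<open>c + eigenval m j\<close>.
  The last clause is its symmetry tested on an eigenfunction; it follows from orthogonality, without
  integration by parts.\<close>

lemma resolvent_on_span:
  assumes c: "c > 0" and "q \<in> fun_vs.span eigenfuns"
  shows "\<exists>r. regular r \<and> (\<forall>x\<in>wedge p. c * r x - laplace_beltrami r x = q x) \<and>
    (\<forall>m\<ge>1. \<forall>j. (c + eigenval m j) * wedge_inner r (eigenfun m j) = wedge_inner q (eigenfun m j))"
proof -
  have "regular q \<and> ?thesis"
    using assms(2)
  proof (induction rule: span_eigenfuns_induct)
    case zero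
    thus ?case using regular_zero laplace_beltrami_zero by (intro conjI exI[of _ "\<lambda>_. 0"]) auto
  next
    case (step a m j f)
    then obtain r where r: "regular r" "\<And>x. x \<in> wedge p \<Longrightarrow> c * r x - laplace_beltrami r x = f x"
      "\<And>m j. m \<ge> 1 \<Longrightarrow> (c + eigenval m j) * wedge_inner r (eigenfun m j) = wedge_inner f (eigenfun m j)"
      and f: "regular f" by blast
    note Y = eigenfun_regular[OF step(1)]
    define a' where "a' = a / (c + eigenval m j)"
    have pos: "c + eigenval m j > 0" using c eigenval_nonneg[of m j] by linarith
    hence a': "a' * (c + eigenval m j) = a" by (simp add: a'_def)
    let ?r = "\<lambda>x. a' * eigenfun m j x + r x"
    have "c * ?r x - laplace_beltrami ?r x = a * eigenfun m j x + f x" if "x \<in> wedge p" for x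
      unfolding regular_lincomb(2)[OF Y(1) r(1) that] Y(2)[OF that] r(2)[OF that, symmetric] a'[symmetric]
      by (simp add: algebra_simps)
    moreover have "(c + eigenval m' j') * wedge_inner ?r (eigenfun m' j')
        = wedge_inner (\<lambda>x. a * eigenfun m j x + f x) (eigenfun m' j')" if m': "m' \<ge> 1" for m' j'
    proof -
      note C0 = regular_wedge_C0[OF Y(1)] regular_wedge_C0[OF r(1)] regular_wedge_C0[OF f] wedge_C0_eigenfun[OF m']
      have "(c + eigenval m' j') * (a' * wedge_inner (eigenfun m j) (eigenfun m' j'))
          = a * wedge_inner (eigenfun m j) (eigenfun m' j')"
      proof (cases "(m, j) = (m', j')")
        case True
        thus ?thesis using a' by (auto simp: mult_ac)
      next
        case False
        thus ?thesis using wedge_inner_eigenfun_orthogonal[OF step(1) m' False] by simp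
      qed
      thus ?thesis
        unfolding wedge_inner_lincomb[OF C0(1,2,4)] wedge_inner_lincomb[OF C0(1,3,4)] distrib_left r(3)[OF m'] by simp
    qed
    ultimately show ?case
      using regular_lincomb(1)[OF Y(1) r(1), of a'] regular_lincomb(1)[OF Y(1) f, of a]
      by (intro conjI exI[of _ ?r] ballI allI impI)
  qed
  thus ?thesis by blast
qed

lemma regular_diff:
  assumes "regular f" "regular g"
  shows "regular (\<lambda>x. c * f x - g x)"
    and "x \<in> wedge p \<Longrightarrow>
      laplace_beltrami (\<lambda>x. c * f x - g x) x = c * laplace_beltrami f x - laplace_beltrami g x"
proof -
  have n: "regular (\<lambda>x. - 1 * g x + 0)" "x \<in> wedge p \<Longrightarrow> laplace_beltrami (\<lambda>x. - 1 * g x + 0) x = - laplace_beltrami g x"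
    using regular_lincomb(1)[OF assms(2) regular_zero, where c = "-1"]
      regular_lincomb(2)[OF assms(2) regular_zero, where c = "-1"] laplace_beltrami_zero by auto
  have eq: "(\<lambda>x. c * f x - g x) = (\<lambda>x. c * f x + (- 1 * g x + 0))" by auto
  show "regular (\<lambda>x. c * f x - g x)" unfolding eq by (rule regular_lincomb(1)[OF assms(1) n(1)])
  show "laplace_beltrami (\<lambda>x. c * f x - g x) x = c * laplace_beltrami f x - laplace_beltrami g x"
    if "x \<in> wedge p"
    unfolding eq regular_lincomb(2)[OF assms(1) n(1) that] n(2)[OF that] by simp
qed

lemma wedge_inner_diff:
  assumes "wedge_C0 f" "wedge_C0 g" "wedge_C0 h"
  shows "wedge_inner (\<lambda>x. c * f x - g x) h = c * wedge_inner f h - wedge_inner g h"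
proof -
  have z: "wedge_C0 (\<lambda>_. 0)" by (simp add: wedge_C0_def)
  have n: "wedge_C0 (\<lambda>x. - 1 * g x + 0)" "wedge_inner (\<lambda>x. - 1 * g x + 0) h = - wedge_inner g h"
    using wedge_C0_lincomb[OF assms(2) z, of "-1"] wedge_inner_lincomb[OF assms(2) z assms(3), of "-1"] by auto
  have eq: "(\<lambda>x. c * f x - g x) = (\<lambda>x. c * f x + (- 1 * g x + 0))" by auto
  show ?thesis unfolding eq wedge_inner_lincomb[OF assms(1) n(1) assms(3)] n(2) by simp
qed

lemma regular_maximum_principle:
  assumes w: "regular w" and c: "c > 0"
    and K: "\<And>x. x \<in> wedge p \<Longrightarrow> \<bar>c * w x - laplace_beltrami w x\<bar> \<le> K" "K \<ge> 0"
  shows "\<bar>w x\<bar> \<le> K / c"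
proof -
  have bound: "v x \<le> K / c" if v: "regular v" "\<And>x. x \<in> wedge p \<Longrightarrow> c * v x - laplace_beltrami v x \<le> K" for v
    by (rule sphere_maximum_principle[OF open_sgn_vimage_wedge wedge_subset_sphere])
       (use v c K(2) in \<open>auto simp: regular_def wedge_C0_def\<close>)
  have n: "regular (\<lambda>x. - 1 * w x + 0)" "\<And>x. x \<in> wedge p \<Longrightarrow> laplace_beltrami (\<lambda>x. - 1 * w x + 0) x = - laplace_beltrami w x"
    using regular_lincomb(1)[OF w regular_zero, where c = "-1"]
      regular_lincomb(2)[OF w regular_zero, where c = "-1"] laplace_beltrami_zero by auto
  have "w x \<le> K / c" by (rule bound[OF w]) (use K in \<open>force simp: abs_le_iff\<close>)
  moreover have "- 1 * w x + 0 \<le> K / c"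
  proof (rule bound[OF n(1)])
    fix x assume x: "x \<in> wedge p"
    show "c * (- 1 * w x + 0) - laplace_beltrami (\<lambda>x. - 1 * w x + 0) x \<le> K"
      unfolding n(2)[OF x] using K(1)[OF x] by (simp add: abs_le_iff)
  qed
  ultimately show ?thesis by (simp add: abs_le_iff)
qed

text \<open>Dividing \<open>u\<close> by \<open>c + \<mu>\<close> gives a resolvent of
  \<open>u\<close>. Approximate \<open>u\<close> by \<open>q\<close> in the span with resolvent
  \<open>r\<close>: by the maximum principle the two resolvents are uniformly close, and
  \<open>r\<close> pairs with the eigenfunction like \<open>q / (c + ?l)\<close>. In the limit
  \<open>a / (c + \<mu>) = a / (c + ?l)\<close>, so \<open>a = 0\<close> for different
  eigenvalues.\<close>

lemma eigenspace_orthogonal: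
  assumes u: "u \<in> dirichlet_eigenspace (wedge p) \<mu>" and m: "m \<ge> 1" and ne: "eigenval m j \<noteq> \<mu>"
  shows "wedge_inner u (eigenfun m j) = 0"
proof -
  let ?Y = "eigenfun m j" and ?l = "eigenval m j"
  \<comment> \<open>\<mu> is an arbitrary real number. This shift makes \<open>c + \<mu>\<close>
    positive, and division by \<open>c\<close> or \<open>c + ?l\<close> does not enlarge an
    error.\<close>
  define c where "c = \<bar>\<mu>\<bar> + 1"
  have c: "c \<ge> 1" "c + \<mu> > 0" "c + ?l \<ge> 1" using eigenval_nonneg[of m j] by (auto simp: c_def)
  have ur: "regular u" and ue: "\<And>x. x \<in> wedge p \<Longrightarrow> laplace_beltrami u x = - \<mu> * u x"
    using u unfolding dirichlet_eigenspace_wedge by auto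
  note YC = wedge_C0_eigenfun[OF m, of j]
  obtain C where C: "C \<ge> 0"
    "\<And>g e. wedge_C0 g \<Longrightarrow> (\<And>x. x \<in> wedge p \<Longrightarrow> \<bar>g x\<bar> \<le> e) \<Longrightarrow> 0 \<le> e \<Longrightarrow> \<bar>wedge_inner g ?Y\<bar> \<le> C * e"
    using wedge_inner_bound[OF YC] by blast
  define a where "a = wedge_inner u ?Y"
  have "a / (c + \<mu>) - a / (c + ?l) = 0"
  proof (rule eq_0_if_le_mult_eps)
    show "2 * C \<ge> 0" using C by simp
    fix e :: real assume e: "e > 0"
    obtain q where q: "q \<in> fun_vs.span eigenfuns" "\<And>x. x \<in> wedge p \<Longrightarrow> \<bar>u x - q x\<bar> \<le> e"
      using span_eigenfuns_dense[OF regular_wedge_C0[OF ur] e] by blast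
    note qr = span_eigenfuns_regular[OF q(1)]
    have "c > 0" using c by simp
    from resolvent_on_span[OF this q(1)] obtain r where r: "regular r"
      "\<And>x. x \<in> wedge p \<Longrightarrow> c * r x - laplace_beltrami r x = q x"
      "(c + ?l) * wedge_inner r ?Y = wedge_inner q ?Y" using m by blast
    \<comment> \<open>The difference of the two resolvents, hence a solution of
      \<open>c * w - \<Delta> w = u - q\<close>.\<close>
    define w where "w x = (1 / (c + \<mu>)) * u x - r x" for x
    have wr: "regular w" unfolding w_def by (rule regular_diff(1)[OF ur r(1)])
    have "c * w x - laplace_beltrami w x = u x - q x" if "x \<in> wedge p" for x
    proof -
      have "c * w x - laplace_beltrami w x = ((c + \<mu>) * (1 / (c + \<mu>))) * u x - (c * r x - laplace_beltrami r x)"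
        unfolding w_def regular_diff(2)[OF ur r(1) that] ue[OF that] by (simp add: algebra_simps)
      thus ?thesis using r(2)[OF that] c by simp
    qed
    hence "\<bar>w x\<bar> \<le> e / c" for x
      by (intro regular_maximum_principle[OF wr]) (use q(2) c e in auto)
    moreover have "e / c \<le> e" using c e by (simp add: field_simps)
    ultimately have "\<bar>w x\<bar> \<le> e" for x using order_trans by blast
    hence 1: "\<bar>wedge_inner w ?Y\<bar> \<le> C * e" using C(2)[OF regular_wedge_C0[OF wr]] e by simp
    have 2: "\<bar>wedge_inner (\<lambda>x. 1 * u x - q x) ?Y\<bar> \<le> C * e"
      using C(2)[OF regular_wedge_C0[OF regular_diff(1)[OF ur qr, of 1]], of e] q(2) e by simp
    have w1: "wedge_inner w ?Y = a / (c + \<mu>) - wedge_inner q ?Y / (c + ?l)"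
    proof -
      have "c + ?l \<noteq> 0" using c by linarith
      hence "wedge_inner r ?Y = wedge_inner q ?Y / (c + ?l)" using r(3) by (metis nonzero_mult_div_cancel_left)
      thus ?thesis
        unfolding w_def a_def wedge_inner_diff[OF regular_wedge_C0[OF ur] regular_wedge_C0[OF r(1)] YC] by simp
    qed
    have w2: "wedge_inner (\<lambda>x. 1 * u x - q x) ?Y = a - wedge_inner q ?Y"
      unfolding a_def wedge_inner_diff[OF regular_wedge_C0[OF ur] regular_wedge_C0[OF qr] YC] by simp
    have "a / (c + \<mu>) - a / (c + ?l) = wedge_inner w ?Y - wedge_inner (\<lambda>x. 1 * u x - q x) ?Y / (c + ?l)"
      unfolding w1 w2 by (simp add: diff_divide_distrib)
    moreover have "\<bar>wedge_inner (\<lambda>x. 1 * u x - q x) ?Y / (c + ?l)\<bar> \<le> \<bar>wedge_inner (\<lambda>x. 1 * u x - q x) ?Y\<bar>"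
    proof -
      have "\<bar>z\<bar> / (c + ?l) \<le> \<bar>z\<bar> / 1" for z :: real
        using c by (intro divide_left_mono) auto
      thus ?thesis using c by (simp add: abs_divide)
    qed
    ultimately show "\<bar>a / (c + \<mu>) - a / (c + ?l)\<bar> \<le> 2 * C * e" using 1 2 by linarith
  qed
  hence "a * (c + ?l) = a * (c + \<mu>)" using c by (auto simp: frac_eq_eq)
  thus ?thesis using ne by (auto simp: a_def)
qed

text \<open>Orthogonality to the span lets \<open>w\<close> be replaced by \<open>w - q\<close> in
  one slot of its own inner product, and density makes that difference uniformly small.\<close>

lemma wedge_inner_complete:
  assumes w: "wedge_C0 w" and orth: "\<And>m j. m \<ge> 1 \<Longrightarrow> wedge_inner w (eigenfun m j) = 0"
  shows "w = (\<lambda>_. 0)"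
proof (rule wedge_inner_self_eq_0[OF w])
  have span: "wedge_C0 q \<and> wedge_inner q w = 0" if "q \<in> fun_vs.span eigenfuns" for q
    using that
  proof (induction rule: span_eigenfuns_induct)
    case (step c m j f)
    note Y = wedge_C0_eigenfun[OF step(1), of j]
    have "wedge_inner (eigenfun m j) w = 0" using orth[OF step(1), of j] by (simp add: wedge_inner_commute)
    thus ?case using step(2) wedge_inner_lincomb[OF Y _ w, of f c] wedge_C0_lincomb[OF Y, of f c] by simp
  qed (simp add: wedge_C0_def)
  obtain C where C: "C \<ge> 0"
    "\<And>g e. wedge_C0 g \<Longrightarrow> (\<And>x. x \<in> wedge p \<Longrightarrow> \<bar>g x\<bar> \<le> e) \<Longrightarrow> 0 \<le> e \<Longrightarrow> \<bar>wedge_inner g w\<bar> \<le> C * e"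
    using wedge_inner_bound[OF w] by blast
  show "wedge_inner w w = 0"
  proof (rule eq_0_if_le_mult_eps[OF C(1)])
    fix e :: real assume e: "e > 0"
    obtain q where q: "q \<in> fun_vs.span eigenfuns" "\<And>x. x \<in> wedge p \<Longrightarrow> \<bar>w x - q x\<bar> \<le> e"
      using span_eigenfuns_dense[OF w e] by blast
    note s = span[OF q(1)]
    have "wedge_C0 (\<lambda>x. w x - q x)"
      using w s by (auto simp: wedge_C0_def intro!: continuous_intros)
    hence "\<bar>wedge_inner (\<lambda>x. w x - q x) w\<bar> \<le> C * e" using C(2) q(2) e by simp
    thus "\<bar>wedge_inner w w\<bar> \<le> C * e" using wedge_inner_diff[OF w _ w, of q 1] s by simp
  qed
qed

section \<open>Multiplicities and the ordered list of eigenvalues\<close>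

definition eigenindex :: "real \<Rightarrow> (nat \<times> nat) set" where
  "eigenindex \<mu> = {(m, j). m \<ge> 1 \<and> eigenval m j = \<mu>}"

lemma inj_on_eigenfun: "inj_on (\<lambda>(m, j). eigenfun m j) {(m, j). m \<ge> 1}"
proof (rule inj_onI, clarify)
  fix m j m' j' :: nat
  assume m: "m \<ge> 1" "m' \<ge> 1" and eq: "eigenfun m j = eigenfun m' j'"
  show "m = m' \<and> j = j'"
  proof (rule ccontr)
    assume "\<not> (m = m' \<and> j = j')"
    hence "wedge_inner (eigenfun m j) (eigenfun m' j') = 0" using m by (intro wedge_inner_eigenfun_orthogonal) auto
    thus False using eq wedge_inner_eigenfun_self_nonzero[OF m(1), of j] by simp
  qed
qed

text \<open>n (n + 1) determines the natural number n, so level \<open>l\<close> consists of the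
  solutions of p m + j = l with m \<ge> 1. The natural-number subtraction does not truncate, as
  \<open>m \<le> l div p\<close> means \<open>p * m \<le> l\<close>.\<close>

lemma eigenindex_eq:
  "eigenindex (real (l * (l + 1))) = (\<lambda>m. (m, l - p * m)) ` {1..l div p}"
proof -
  have inj: "i = k" if "i * (i + 1) = k * (k + 1)" for i k :: nat
  proof (rule ccontr)
    assume "i \<noteq> k"
    hence "i < k \<or> k < i" by linarith
    hence "i * (i + 1) < k * (k + 1) \<or> k * (k + 1) < i * (i + 1)"
      by (metis add_mono_thms_linordered_field(1) mult_strict_mono' le0)
    thus False using that by simp
  qed
  have "(m, j) \<in> eigenindex (real (l * (l + 1))) \<longleftrightarrow> m \<ge> 1 \<and> p * m + j = l" for m j
  proof -
    have "eigenval m j = real (l * (l + 1)) \<longleftrightarrow> (p * m + j) * (p * m + j + 1) = l * (l + 1)"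
      unfolding eigenval_def by (rule of_nat_eq_iff)
    also have "\<dots> \<longleftrightarrow> p * m + j = l" using inj by blast
    finally show ?thesis by (simp add: eigenindex_def)
  qed
  moreover have "m \<le> l div p \<longleftrightarrow> p * m \<le> l" for m
    using p by (simp add: less_eq_div_iff_mult_less_eq mult.commute)
  ultimately show ?thesis by (auto simp: image_iff)
qed

lemma card_eigenindex:
  "finite (eigenindex (real (l * (l + 1))))" "card (eigenindex (real (l * (l + 1)))) = l div p"
proof -
  have "inj_on (\<lambda>m. (m, l - p * m)) {1..l div p}" by (rule inj_onI) auto
  thus "card (eigenindex (real (l * (l + 1)))) = l div p" unfolding eigenindex_eq by (simp add: card_image)
  show "finite (eigenindex (real (l * (l + 1))))" unfolding eigenindex_eq by simp
qed

lemma eigenindex_empty: "(\<And>l::nat. \<mu> \<noteq> real (l * (l + 1))) \<Longrightarrow> eigenindex \<mu> = {}"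
proof (rule equals0I, clarify)
  fix m j assume no: "\<And>l::nat. \<mu> \<noteq> real (l * (l + 1))" and "(m, j) \<in> eigenindex \<mu>"
  hence "real ((p * m + j) * (p * m + j + 1)) = \<mu>"
    by (simp only: eigenindex_def eigenval_def mem_Collect_eq case_prod_conv)
  thus False using no[of "p * m + j"] by metis
qed

lemma finite_eigenindex: "finite (eigenindex \<mu>)"
  using card_eigenindex(1) eigenindex_empty by (metis finite.emptyI)

lemma wedge_inner_sum:
  assumes "finite X" "\<And>i. i \<in> X \<Longrightarrow> wedge_C0 (f i)" "wedge_C0 h"
  shows "wedge_C0 (\<lambda>x. \<Sum>i\<in>X. c i * f i x)"
    and "wedge_inner (\<lambda>x. \<Sum>i\<in>X. c i * f i x) h = (\<Sum>i\<in>X. c i * wedge_inner (f i) h)"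
proof -
  have "wedge_C0 (\<lambda>x. \<Sum>i\<in>X. c i * f i x) \<and>
      wedge_inner (\<lambda>x. \<Sum>i\<in>X. c i * f i x) h = (\<Sum>i\<in>X. c i * wedge_inner (f i) h)"
    using assms(1,2)
  proof (induction X rule: finite_induct)
    case empty
    thus ?case by (simp add: wedge_C0_def)
  next
    case (insert k X)
    thus ?case using assms(3) by (simp add: wedge_C0_lincomb wedge_inner_lincomb)
  qed
  thus "wedge_C0 (\<lambda>x. \<Sum>i\<in>X. c i * f i x)"
    "wedge_inner (\<lambda>x. \<Sum>i\<in>X. c i * f i x) h = (\<Sum>i\<in>X. c i * wedge_inner (f i) h)" by blast+
qed

text \<open>Subtract from an eigenfunction its orthogonal projection \<open>?s\<close> to the finite
  set \<open>B\<close>. The rest is orthogonal to \<open>B\<close> by the choice of coefficients and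
  to the other explicit eigenfunctions because their eigenvalues differ, so completeness makes it
  zero. If \<mu> is no level, \<open>B\<close> is empty and the eigenspace trivial.\<close>

lemma eigenspace_basis:
  fixes \<mu> :: real
  defines "B \<equiv> (\<lambda>(m, j). eigenfun m j) ` eigenindex \<mu>"
  shows "finite B" "card B = card (eigenindex \<mu>)" "fun_vs.independent B"
    "fun_vs.span B = dirichlet_eigenspace (wedge p) \<mu>"
proof -
  let ?X = "eigenindex \<mu>" and ?Y = "\<lambda>(m, j). eigenfun m j"
  have X: "m \<ge> 1" if "(m, j) \<in> ?X" for m j using that by (simp add: eigenindex_def)
  show fin: "finite B" unfolding B_def by (intro finite_imageI finite_eigenindex)
  have inj: "inj_on ?Y ?X" by (rule inj_on_subset[OF inj_on_eigenfun]) (auto dest: X)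
  thus "card B = card ?X" unfolding B_def by (rule card_image)
  have orth: "wedge_inner v w = 0" if "v \<in> B" "w \<in> B" "v \<noteq> w" for v w
  proof -
    obtain m j m' j' where "v = eigenfun m j" "w = eigenfun m' j'" "(m, j) \<in> ?X" "(m', j') \<in> ?X"
      using \<open>v \<in> B\<close> \<open>w \<in> B\<close> unfolding B_def by auto
    thus ?thesis using that X by (auto intro!: wedge_inner_eigenfun_orthogonal)
  qed
  have BC: "wedge_C0 v" "wedge_inner v v \<noteq> 0" if "v \<in> B" for v
    using that X wedge_C0_eigenfun wedge_inner_eigenfun_self_nonzero unfolding B_def by auto
  show "fun_vs.independent B"
  proof (rule fun_vs.independent_if_scalars_zero[OF fin])
    fix f :: "(real ^ 3 \<Rightarrow> real) \<Rightarrow> real" and w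
    assume "(\<Sum>v\<in>B. (\<lambda>x. f v * v x)) = 0" and w: "w \<in> B"
    hence "(\<lambda>x. \<Sum>v\<in>B. f v * v x) = (\<lambda>_. 0)" by (simp add: sum_fun_eq zero_fun_def)
    hence "(\<Sum>v\<in>B. f v * wedge_inner v w) = 0"
      using wedge_inner_sum(2)[where f = "\<lambda>v. v" and c = f, OF fin BC(1) BC(1)[OF w]] by simp
    also have "(\<Sum>v\<in>B. f v * wedge_inner v w) = (\<Sum>v\<in>B. if v = w then f w * wedge_inner w w else 0)"
      by (rule sum.cong) (use orth w in auto)
    also have "\<dots> = f w * wedge_inner w w" using fin w by simp
    finally show "f w = 0" using BC(2)[OF w] by simp
  qed
  show "fun_vs.span B = dirichlet_eigenspace (wedge p) \<mu>"
  proof (intro equalityI subsetI)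
    fix u assume "u \<in> fun_vs.span B"
    thus "u \<in> dirichlet_eigenspace (wedge p) \<mu>"
    proof (induction rule: fun_vs.span_induct_alt)
      case base
      thus ?case using regular_zero laplace_beltrami_zero
        by (simp add: dirichlet_eigenspace_wedge zero_fun_def)
    next
      case (step c y f)
      then obtain m j where y: "y = eigenfun m j" "m \<ge> 1" "eigenval m j = \<mu>"
        unfolding B_def eigenindex_def by auto
      have f: "regular f" "\<And>x. x \<in> wedge p \<Longrightarrow> laplace_beltrami f x = - \<mu> * f x"
        using step.IH unfolding dirichlet_eigenspace_wedge by auto
      note Y = eigenfun_regular[OF y(2), where j = j, folded y(1)]
      have "- laplace_beltrami (\<lambda>x. c * y x + f x) x = \<mu> * (c * y x + f x)" if "x \<in> wedge p" for x
        unfolding regular_lincomb(2)[OF Y(1) f(1) that] Y(2)[OF that] f(2)[OF that] y(3)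
        by (simp add: algebra_simps)
      thus ?case using regular_lincomb(1)[OF Y(1) f(1), of c]
        by (simp add: dirichlet_eigenspace_wedge plus_fun_def)
    qed
  next
    fix u assume u: "u \<in> dirichlet_eigenspace (wedge p) \<mu>"
    hence uC: "wedge_C0 u" by (simp add: dirichlet_eigenspace_wedge regular_def)
    define f where "f v = wedge_inner u v / wedge_inner v v" for v
    let ?s = "\<lambda>x. \<Sum>v\<in>B. f v * v x"
    have sC: "wedge_C0 ?s" using wedge_inner_sum(1)[where f = "\<lambda>v. v" and c = f, OF fin BC(1) uC] .
    have "wedge_inner (\<lambda>x. 1 * u x - ?s x) (eigenfun m j) = 0" if m: "m \<ge> 1" for m j
    proof -
      let ?Z = "eigenfun m j"
      have s: "wedge_inner ?s ?Z = (\<Sum>v\<in>B. f v * wedge_inner v ?Z)"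
        using wedge_inner_sum(2)[where f = "\<lambda>v. v" and c = f, OF fin BC(1) wedge_C0_eigenfun[OF m]] .
      have "wedge_inner u ?Z = (\<Sum>v\<in>B. f v * wedge_inner v ?Z)"
      proof (cases "?Z \<in> B")
        case True
        have "(\<Sum>v\<in>B. f v * wedge_inner v ?Z) = (\<Sum>v\<in>B. if v = ?Z then f ?Z * wedge_inner ?Z ?Z else 0)"
          by (rule sum.cong) (use orth True in auto)
        also have "\<dots> = wedge_inner u ?Z" using fin True BC(2)[OF True] by (simp add: f_def)
        finally show ?thesis by simp
      next
        case False
        hence ni: "(m, j) \<notin> ?X" unfolding B_def by force
        have "wedge_inner v ?Z = 0" if v: "v \<in> B" for v
        proof -
          obtain m' j' where mj: "v = eigenfun m' j'" "(m', j') \<in> ?X" using v unfolding B_def by auto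
          hence "(m', j') \<noteq> (m, j)" using ni by blast
          thus ?thesis unfolding mj(1) by (rule wedge_inner_eigenfun_orthogonal[OF X[OF mj(2)] m])
        qed
        moreover have "eigenval m j \<noteq> \<mu>" using ni m by (simp add: eigenindex_def)
        ultimately show ?thesis using eigenspace_orthogonal[OF u m] by simp
      qed
      thus ?thesis using wedge_inner_diff[OF uC sC wedge_C0_eigenfun[OF m], where c = 1] s by simp
    qed
    moreover have "wedge_C0 (\<lambda>x. 1 * u x - ?s x)"
      using uC sC by (auto simp: wedge_C0_def intro!: continuous_intros)
    ultimately have "(\<lambda>x. 1 * u x - ?s x) = (\<lambda>_. 0)" by (intro wedge_inner_complete)
    hence "u = ?s" by (auto simp: fun_eq_iff)
    hence "u = (\<Sum>v\<in>B. (\<lambda>x. f v * v x))" by (simp add: sum_fun_eq)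
    also have "\<dots> \<in> fun_vs.span B"
      by (intro fun_vs.span_sum fun_vs.span_scale fun_vs.span_base)
    finally show "u \<in> fun_vs.span B" .
  qed
qed

text \<open>The explicit list has the right multiplicity at every real \<mu>, also at those that are
  no eigenvalue, where both counts are 0. Uniqueness then identifies it with the list chosen by
  \<open>THE\<close>.\<close>

lemma dirichlet_eigenvalue_wedge_ge:
  assumes k: "k \<ge> 1"
  shows "dirichlet_eigenvalue (wedge p) k \<ge> 2 * real p * real k"
proof -
  obtain L :: "nat \<Rightarrow> nat" where L: "mono L" "\<And>l. finite {i. L i = l}"
    "\<And>l. card {i. L i = l} = l div p" "\<And>i. 2 * p * Suc i \<le> L i * (L i + 1)"
    using exists_enumeration_with_multiplicities[OF p] by blast
  define lam where "lam i = real (L i * (L i + 1))" for i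
  have fib: "finite {i. lam i = \<mu>} \<and> card {i. lam i = \<mu>} = card (eigenindex \<mu>)" for \<mu>
  proof (cases "\<exists>l::nat. \<mu> = real (l * (l + 1))")
    case True
    then obtain l :: nat where l: "\<mu> = real (l * (l + 1))" by blast
    have "lam i = \<mu> \<longleftrightarrow> L i = l" for i
    proof -
      have "strict_mono (\<lambda>l::nat. l * (l + 1))" by (intro strict_monoI mult_strict_mono) auto
      hence "L i * (L i + 1) = l * (l + 1) \<longleftrightarrow> L i = l" by (rule strict_mono_eq)
      thus ?thesis unfolding lam_def l of_nat_eq_iff .
    qed
    thus ?thesis using L(2,3) card_eigenindex l by simp
  next
    case False
    hence "{i. lam i = \<mu>} = {}" "eigenindex \<mu> = {}" using eigenindex_empty by (auto simp: lam_def)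
    thus ?thesis by simp
  qed
  have "mono lam"
  proof
    fix i j :: nat assume "i \<le> j"
    hence "L i * (L i + 1) \<le> L j * (L j + 1)" using monoD[OF L(1)] by (intro mult_le_mono add_mono) auto
    thus "lam i \<le> lam j" unfolding lam_def by (rule of_nat_mono)
  qed
  hence enum: "enumerates_dirichlet_spectrum (wedge p) lam"
    unfolding enumerates_dirichlet_spectrum_def using fib eigenspace_basis by metis
  have "(THE lam. enumerates_dirichlet_spectrum (wedge p) lam) = lam"
    by (rule the_equality, rule enum, rule enumerates_dirichlet_spectrum_unique[OF _ enum])
  hence "dirichlet_eigenvalue (wedge p) k = lam (k - 1)" by (simp add: dirichlet_eigenvalue_def)
  \<comment> \<open>The shift from \<open>k\<close> to the index \<open>k - 1\<close> cancels the
    \<open>Suc\<close> in the bound for \<open>L\<close>.\<close>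
  moreover have "2 * p * k \<le> L (k - 1) * (L (k - 1) + 1)" using L(4)[of "k - 1"] k by simp
  hence "real (2 * p * k) \<le> lam (k - 1)" unfolding lam_def by (rule of_nat_mono)
  ultimately show ?thesis by simp
qed

end

theorem theorem5:
  fixes p k :: nat
  assumes "p \<ge> 1" and "k \<ge> 1"
  shows "dirichlet_eigenvalue (wedge p) k \<ge> weyl_constant (wedge p) * real k"
proof -
  interpret wedge_geometry p "pi / (2 * real p)"
    using assms by unfold_locales auto
  have "weyl_constant (wedge p) * real k \<le> 2 * real p * real k"
    using weyl_constant_wedge_le by (rule mult_right_mono) simp
  also have "\<dots> \<le> dirichlet_eigenvalue (wedge p) k"
    using dirichlet_eigenvalue_wedge_ge[OF assms(2)] .
  finally show ?thesis .
qed

end
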